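(* Let $n\ge 1$ be an integer, let $\mathcal{Y}$ be a Hilbert space and let $\mathcal{M}$ be a closed $S_n$-invariant subspace of $\mathcal{A}_n(\mathcal{Y})$. Then there exist Hilbert spaces $\mathcal{U}_1,\dots,\mathcal{U}_n$ and holomorphic functions $F_j:\mathbb{D}\to\mathcal{L}(\mathcal{U}_j,\mathcal{Y})$ ($j=1,\dots,n$) such that, with $F(z)=\begin{bmatrix}F_1(z)&\cdots&F_n(z)\end{bmatrix}$, the multiplication operator $$M_F=\begin{bmatrix}M_{F_1}&\cdots&M_{F_n}\end{bmatrix}:\ \bigoplus_{j=1}^n\mathcal{A}_j(\mathcal{U}_j)\to\mathcal{A}_n(\mathcal{Y}),\qquad M_F:\ (h_1,\dots,h_n)\mapsto F_1h_1+\cdots+F_nh_n,$$ is a partial isometry and $$\mathcal{M}=M_F\Big(\bigoplus_{j=1}^n\mathcal{A}_j(\mathcal{U}_j)\Big).$$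
   Context: $\mathcal{L}(\mathcal{U},\mathcal{Y})$ denotes the bounded linear operators between Hilbert spaces and $\mathbb{D}$ the open unit disk. For an integer $n\ge1$ and a Hilbert space $\mathcal{Y}$, $\mathcal{A}_n(\mathcal{Y})$ is the Hilbert space of $\mathcal{Y}$-valued functions $f(z)=\sum_{j\ge0}f_jz^j$ analytic on $\mathbb{D}$ with $\|f\|^2_{\mathcal{A}_n(\mathcal{Y})}=\sum_{j\ge0}\mu_{n,j}\|f_j\|^2_{\mathcal{Y}}<\infty$, where $\mu_{n,j}=1/\binom{n+j-1}{j}$. Equivalently, it is the reproducing kernel Hilbert space with kernel $(1-z\overline{\zeta})^{-n}I_{\mathcal{Y}}$. The Bergman shift $S_n$ on $\mathcal{A}_n(\mathcal{Y})$ is $S_n:f(z)\mapsto zf(z)$. *)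

theory Defs
  imports "HOL-Analysis.Analysis" "HOL-Library.Function_Algebras"
begin

class complex_vector = ab_group_add +
  fixes scaleC :: "complex \<Rightarrow> 'a \<Rightarrow> 'a"  (infixr \<open>*\<^sub>C\<close> 75)
  assumes scaleC_add_right: "a *\<^sub>C (x + y) = a *\<^sub>C x + a *\<^sub>C y"
    and scaleC_add_left: "(a + b) *\<^sub>C x = a *\<^sub>C x + b *\<^sub>C x"
    and scaleC_scaleC: "a *\<^sub>C (b *\<^sub>C x) = (a * b) *\<^sub>C x"
    and scaleC_one: "1 *\<^sub>C x = x"

global_interpretation complex_vector: vector_space "scaleC :: complex \<Rightarrow> 'a \<Rightarrow> 'a::complex_vector"
  by unfold_locales
    (simp_all add: scaleC_add_right scaleC_add_left scaleC_scaleC scaleC_one)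

instantiation complex :: complex_vector
begin
definition scaleC_complex :: "complex \<Rightarrow> complex \<Rightarrow> complex" where
  "scaleC_complex = (*)"
instance
  by standard (simp_all add: scaleC_complex_def algebra_simps)
end

instantiation "fun" :: (type, complex_vector) complex_vector
begin
definition scaleC_fun :: "complex \<Rightarrow> ('a \<Rightarrow> 'b) \<Rightarrow> 'a \<Rightarrow> 'b" where
  "scaleC_fun a f = (\<lambda>x. a *\<^sub>C f x)"
instance
  by standard
    (simp_all add: scaleC_fun_def plus_fun_def fun_eq_iff
      scaleC_add_right scaleC_add_left scaleC_scaleC scaleC_one)
end

text \<open>
  A Hilbert space consists of a linear subspace of some complex vector space type and an inner
  product on that subspace. Carrying the underlying set explicitly makes it possible to quantify
  existentially over Hilbert spaces and to index families of them by numbers. The inner product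
  is linear in its first argument; its values outside the underlying set are irrelevant.
\<close>

record 'v hilbert =
  hcarrier :: "'v set"
  hinner :: "'v \<Rightarrow> 'v \<Rightarrow> complex"

definition hnorm :: "'v hilbert \<Rightarrow> 'v \<Rightarrow> real" where
  "hnorm H x = sqrt (Re (hinner H x x))"

text \<open>
  The case distinction is there because \<open>Metric_space\<close> demands a nonnegative symmetric
  distance on the whole type.
\<close>

definition hdist :: "'v::complex_vector hilbert \<Rightarrow> 'v \<Rightarrow> 'v \<Rightarrow> real" where
  "hdist H x y = (if x \<in> hcarrier H \<and> y \<in> hcarrier H then hnorm H (x - y) else 0)"

definition htopology :: "'v::complex_vector hilbert \<Rightarrow> 'v topology" where
  "htopology H = Metric_space.mtopology (hcarrier H) (hdist H)"

locale complex_hilbert_space =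
  fixes H :: "'v::complex_vector hilbert"
  assumes subspace_carrier: "complex_vector.subspace (hcarrier H)"
    and inner_add_left:
      "\<lbrakk>x \<in> hcarrier H; y \<in> hcarrier H; z \<in> hcarrier H\<rbrakk>
        \<Longrightarrow> hinner H (x + y) z = hinner H x z + hinner H y z"
    and inner_scale_left:
      "\<lbrakk>x \<in> hcarrier H; y \<in> hcarrier H\<rbrakk> \<Longrightarrow> hinner H (c *\<^sub>C x) y = c * hinner H x y"
    and inner_cnj:
      "\<lbrakk>x \<in> hcarrier H; y \<in> hcarrier H\<rbrakk> \<Longrightarrow> hinner H y x = cnj (hinner H x y)"
    and inner_nonneg: "x \<in> hcarrier H \<Longrightarrow> 0 \<le> Re (hinner H x x)"
    and inner_definite: "\<lbrakk>x \<in> hcarrier H; hinner H x x = 0\<rbrakk> \<Longrightarrow> x = 0"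
    and complete: "Metric_space.mcomplete (hcarrier H) (hdist H)"

definition closed_subspace :: "'v::complex_vector hilbert \<Rightarrow> 'v set \<Rightarrow> bool" where
  "closed_subspace H M \<longleftrightarrow>
     M \<subseteq> hcarrier H \<and> complex_vector.subspace M \<and> closedin (htopology H) M"

definition hsums :: "'v::complex_vector hilbert \<Rightarrow> (nat \<Rightarrow> 'v) \<Rightarrow> 'v \<Rightarrow> bool" where
  "hsums H a s \<longleftrightarrow> limitin (htopology H) (\<lambda>N. \<Sum>j<N. a j) s sequentially"

text \<open>
  The direct sum of the Hilbert spaces \<open>H j\<close>, \<open>j \<in> J\<close>, for a finite index set
  \<open>J\<close>. Its elements are families that vanish outside \<open>J\<close>, so that each element of
  the direct sum is represented by exactly one function.
\<close>

definition direct_sum :: "'i set \<Rightarrow> ('i \<Rightarrow> 'v::complex_vector hilbert) \<Rightarrow> ('i \<Rightarrow> 'v) hilbert" where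
  "direct_sum J H =
     \<lparr>hcarrier = {h. (\<forall>j\<in>J. h j \<in> hcarrier (H j)) \<and> (\<forall>j. j \<notin> J \<longrightarrow> h j = 0)},
      hinner = (\<lambda>g h. \<Sum>j\<in>J. hinner (H j) (g j) (h j))\<rparr>"

text \<open>
  Operators are total functions of which only the restriction to the domain space matters.
\<close>

definition bounded_operators ::
  "'u::complex_vector hilbert \<Rightarrow> 'v::complex_vector hilbert \<Rightarrow> ('u \<Rightarrow> 'v) set" where
  "bounded_operators H K =
     {T. (\<forall>x\<in>hcarrier H. T x \<in> hcarrier K) \<and>
         (\<forall>x\<in>hcarrier H. \<forall>y\<in>hcarrier H. T (x + y) = T x + T y) \<and>
         (\<forall>c. \<forall>x\<in>hcarrier H. T (c *\<^sub>C x) = c *\<^sub>C T x) \<and>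
         (\<exists>C. \<forall>x\<in>hcarrier H. hnorm K (T x) \<le> C * hnorm H x)}"

definition operator_norm ::
  "'u::complex_vector hilbert \<Rightarrow> 'v::complex_vector hilbert \<Rightarrow> ('u \<Rightarrow> 'v) \<Rightarrow> real" where
  "operator_norm H K T = (SUP x\<in>{x \<in> hcarrier H. hnorm H x \<le> 1}. hnorm K (T x))"

text \<open>
  Isometric on the orthogonal complement of the kernel.
\<close>

definition partial_isometry ::
  "'u::complex_vector hilbert \<Rightarrow> 'v::complex_vector hilbert \<Rightarrow> ('u \<Rightarrow> 'v) \<Rightarrow> bool" where
  "partial_isometry H K T \<longleftrightarrow>
     T \<in> bounded_operators H K \<and>
     (\<forall>x\<in>hcarrier H. (\<forall>y\<in>hcarrier H. T y = 0 \<longrightarrow> hinner H x y = 0) \<longrightarrow>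
        hnorm K (T x) = hnorm H x)"

abbreviation unit_disk :: "complex set" where
  "unit_disk \<equiv> ball 0 1"

text \<open>
  Holomorphy of \<open>F : \<D> \<rightarrow> L(H, K)\<close>: complex differentiability in the operator norm.
\<close>

definition holomorphic_operator_function ::
  "'u::complex_vector hilbert \<Rightarrow> 'v::complex_vector hilbert \<Rightarrow> (complex \<Rightarrow> 'u \<Rightarrow> 'v) \<Rightarrow> bool" where
  "holomorphic_operator_function H K F \<longleftrightarrow>
     (\<forall>z\<in>unit_disk. F z \<in> bounded_operators H K) \<and>
     (\<forall>z\<in>unit_disk. \<exists>D\<in>bounded_operators H K.
        ((\<lambda>w. operator_norm H K (inverse (w - z) *\<^sub>C (F w - F z) - D)) \<longlongrightarrow> 0) (at z))"

text \<open>
  Functions on the disk are represented by total functions that vanish off the disk, so that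
  functions agreeing on the disk are equal.
\<close>

definition power_series_on_disk ::
  "'v::complex_vector hilbert \<Rightarrow> (complex \<Rightarrow> 'v) \<Rightarrow> (nat \<Rightarrow> 'v) \<Rightarrow> bool" where
  "power_series_on_disk Y f a \<longleftrightarrow>
     (\<forall>j. a j \<in> hcarrier Y) \<and>
     (\<forall>z\<in>unit_disk. hsums Y (\<lambda>j. z ^ j *\<^sub>C a j) (f z)) \<and>
     (\<forall>z. z \<notin> unit_disk \<longrightarrow> f z = 0)"

text \<open>
  In a Hilbert space the coefficients of a convergent power series are unique, so \<open>THE\<close> is
  well defined on functions that have such an expansion.
\<close>

definition taylor_coeffs :: "'v::complex_vector hilbert \<Rightarrow> (complex \<Rightarrow> 'v) \<Rightarrow> nat \<Rightarrow> 'v" where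
  "taylor_coeffs Y f = (THE a. power_series_on_disk Y f a)"

text \<open>
  Only meant for \<open>n \<ge> 1\<close>, because of the truncated subtraction.
\<close>

definition bergman_weight :: "nat \<Rightarrow> nat \<Rightarrow> real" where
  "bergman_weight n j = 1 / real ((n + j - 1) choose j)"

definition bergman_space :: "nat \<Rightarrow> 'v::complex_vector hilbert \<Rightarrow> (complex \<Rightarrow> 'v) hilbert" where
  "bergman_space n Y =
     \<lparr>hcarrier = {f. \<exists>a. power_series_on_disk Y f a \<and>
                       summable (\<lambda>j. bergman_weight n j * (hnorm Y (a j))\<^sup>2)},
      hinner = (\<lambda>f g. \<Sum>j. of_real (bergman_weight n j) *
                        hinner Y (taylor_coeffs Y f j) (taylor_coeffs Y g j))\<rparr>"

definition bergman_shift :: "(complex \<Rightarrow> 'v::complex_vector) \<Rightarrow> complex \<Rightarrow> 'v" where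
  "bergman_shift f = (\<lambda>z. z *\<^sub>C f z)"

definition row_multiplier ::
  "nat \<Rightarrow> (nat \<Rightarrow> complex \<Rightarrow> 'u \<Rightarrow> 'v::complex_vector) \<Rightarrow> (nat \<Rightarrow> complex \<Rightarrow> 'u) \<Rightarrow> complex \<Rightarrow> 'v" where
  "row_multiplier n F h = (\<lambda>z. if z \<in> unit_disk then \<Sum>j=1..n. F j z (h j z) else 0)"

end

theory Submission
  imports Defs
begin

text \<open>
  Write \<open>A\<close> for \<open>A\<^sub>n(Y)\<close>, \<open>S\<close> for its shift and \<open>P\<close> for the orthogonal projection onto \<open>M\<close>. The whole
  of \<open>M\<close> is already the image of a single Hardy space \<open>A\<^sub>1(U)\<close>, so one takes \<open>U\<^sub>1 = U\<close>, and
  \<open>U\<^sub>j = {0}\<close>, \<open>F\<^sub>j = 0\<close> for \<open>j \<ge> 2\<close>. The reason is that the weights \<open>\<mu>\<^sub>n\<^sub>,\<^sub>j\<close> decrease in \<open>j\<close>: hence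
  \<open>S\<close> is a contraction, and \<open>S\<^sup>*\<^sup>k \<rightarrow> 0\<close> strongly because \<open>\<parallel>S\<^sup>*\<^sup>k f\<parallel>\<^sup>2\<close> is bounded by a tail of the
  series of \<open>\<parallel>f\<parallel>\<^sup>2\<close>. Both properties pass to the restriction \<open>T\<close> of \<open>S\<close> to \<open>M\<close>, whose adjoint is
  \<open>T\<^sup>* = P S\<^sup>*\<close>.

  Suppose that \<open>I - T T\<^sup>* = G G\<^sup>*\<close> for some \<open>G : U \<rightarrow> M\<close>. Then
  \<open>\<parallel>G\<^sup>* T\<^sup>*\<^sup>k f\<parallel>\<^sup>2 = \<parallel>T\<^sup>*\<^sup>k f\<parallel>\<^sup>2 - \<parallel>T\<^sup>*\<^sup>k\<^sup>+\<^sup>1 f\<parallel>\<^sup>2\<close>, and summing this telescoping identity shows that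
  \<open>f \<mapsto> \<Sum> z\<^sup>k G\<^sup>* T\<^sup>*\<^sup>k f\<close> is an isometry from \<open>M\<close> into \<open>A\<^sub>1(U)\<close>. Its adjoint is
  \<open>\<Sum> z\<^sup>k h\<^sub>k \<mapsto> \<Sum> T\<^sup>k G h\<^sub>k\<close>. The adjoint of an isometry is a partial isometry onto (lemma
  \<open>coisometry\<close>). As \<open>T\<close> is multiplication by \<open>z\<close>, evaluating at a point of the disk identifies this
  adjoint with the multiplication operator of \<open>F\<^sub>1(z) u = (G u)(z)\<close> (lemma \<open>control_multiplier\<close>).

  A factor \<open>G\<close> can be written down explicitly, since
  \<open>I - T T\<^sup>* = P (I - S S\<^sup>*) P + P S (I - P) S\<^sup>* P\<close> on \<open>M\<close> and \<open>I - S S\<^sup>*\<close> is diagonal in the Taylor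
  coefficients with an explicit square root \<open>E\<close>. So \<open>U\<close> is the sum of two copies of \<open>A\<close> and
  \<open>G\<^sup>* f = (E f, (I - P) S\<^sup>* f)\<close>.
\<close>


section \<open>Inner product spaces with an explicit carrier\<close>

text \<open>
  The inner product axioms are separated from completeness: the algebra of operators depends on
  them alone, and completeness of a newly built space is proved with the norm facts of its inner
  product.
\<close>

locale complex_inner_space =
  fixes H :: "'v::complex_vector hilbert"
  assumes subspace_carrier: "complex_vector.subspace (hcarrier H)"
    and inner_add_left:
      "\<lbrakk>x \<in> hcarrier H; y \<in> hcarrier H; z \<in> hcarrier H\<rbrakk>
        \<Longrightarrow> hinner H (x + y) z = hinner H x z + hinner H y z"
    and inner_scale_left:
      "\<lbrakk>x \<in> hcarrier H; y \<in> hcarrier H\<rbrakk> \<Longrightarrow> hinner H (c *\<^sub>C x) y = c * hinner H x y"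
    and inner_cnj:
      "\<lbrakk>x \<in> hcarrier H; y \<in> hcarrier H\<rbrakk> \<Longrightarrow> hinner H y x = cnj (hinner H x y)"
    and inner_nonneg: "x \<in> hcarrier H \<Longrightarrow> 0 \<le> Re (hinner H x x)"
    and inner_definite: "\<lbrakk>x \<in> hcarrier H; hinner H x x = 0\<rbrakk> \<Longrightarrow> x = 0"
begin

lemma zero_closed [simp]: "0 \<in> hcarrier H"
  using subspace_carrier by (rule complex_vector.subspace_0)

lemma add_closed [simp]: "x \<in> hcarrier H \<Longrightarrow> y \<in> hcarrier H \<Longrightarrow> x + y \<in> hcarrier H"
  using subspace_carrier by (rule complex_vector.subspace_add)

lemma diff_closed [simp]: "x \<in> hcarrier H \<Longrightarrow> y \<in> hcarrier H \<Longrightarrow> x - y \<in> hcarrier H"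
  using subspace_carrier by (rule complex_vector.subspace_diff)

lemma minus_closed [simp]: "x \<in> hcarrier H \<Longrightarrow> - x \<in> hcarrier H"
  using diff_closed[of 0 x] zero_closed by simp

lemma scale_closed [simp]: "x \<in> hcarrier H \<Longrightarrow> c *\<^sub>C x \<in> hcarrier H"
  using subspace_carrier by (rule complex_vector.subspace_scale)

lemma sum_closed [simp]: "(\<And>i. i \<in> I \<Longrightarrow> f i \<in> hcarrier H) \<Longrightarrow> sum f I \<in> hcarrier H"
  using subspace_carrier by (rule complex_vector.subspace_sum)

lemma inner_add_right:
  "\<lbrakk>x \<in> hcarrier H; y \<in> hcarrier H; z \<in> hcarrier H\<rbrakk>
    \<Longrightarrow> hinner H z (x + y) = hinner H z x + hinner H z y"
  using inner_cnj[of "x + y" z] inner_cnj[of x z] inner_cnj[of y z] by (simp add: inner_add_left)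

lemma inner_scale_right:
  "\<lbrakk>x \<in> hcarrier H; y \<in> hcarrier H\<rbrakk> \<Longrightarrow> hinner H y (c *\<^sub>C x) = cnj c * hinner H y x"
  using inner_cnj[of "c *\<^sub>C x" y] inner_cnj[of x y] by (simp add: inner_scale_left)

lemma inner_diff_left:
  "\<lbrakk>x \<in> hcarrier H; y \<in> hcarrier H; z \<in> hcarrier H\<rbrakk>
    \<Longrightarrow> hinner H (x - y) z = hinner H x z - hinner H y z"
  using inner_add_left[of "x - y" y z] by simp

lemma inner_diff_right:
  "\<lbrakk>x \<in> hcarrier H; y \<in> hcarrier H; z \<in> hcarrier H\<rbrakk>
    \<Longrightarrow> hinner H z (x - y) = hinner H z x - hinner H z y"
  using inner_add_right[of "x - y" y z] by simp

lemma inner_zero_left [simp]: "x \<in> hcarrier H \<Longrightarrow> hinner H 0 x = 0"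
  using inner_add_left[of 0 0 x] by simp

lemma inner_zero_right [simp]: "x \<in> hcarrier H \<Longrightarrow> hinner H x 0 = 0"
  using inner_add_right[of 0 0 x] by simp

lemma inner_sum_left:
  assumes "\<And>i. i \<in> I \<Longrightarrow> f i \<in> hcarrier H" "x \<in> hcarrier H"
  shows "hinner H (sum f I) x = (\<Sum>i\<in>I. hinner H (f i) x)"
  using assms by (induction I rule: infinite_finite_induct) (auto simp: inner_add_left)

lemma inner_self: "x \<in> hcarrier H \<Longrightarrow> hinner H x x = of_real ((hnorm H x)\<^sup>2)"
  using inner_cnj[of x x] inner_nonneg[of x]
  by (simp add: hnorm_def complex_eq_iff)

lemma hnorm_nonneg [simp]: "x \<in> hcarrier H \<Longrightarrow> 0 \<le> hnorm H x"
  using inner_nonneg by (simp add: hnorm_def)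

lemma hnorm_sq: "x \<in> hcarrier H \<Longrightarrow> (hnorm H x)\<^sup>2 = Re (hinner H x x)"
  using inner_nonneg by (simp add: hnorm_def)

lemma hnorm_eq_0 [simp]: "x \<in> hcarrier H \<Longrightarrow> hnorm H x = 0 \<longleftrightarrow> x = 0"
  using inner_self[of x] inner_definite[of x] by auto

lemma hnorm_zero [simp]: "hnorm H 0 = 0"
  by simp

lemma hnorm_scale: "x \<in> hcarrier H \<Longrightarrow> hnorm H (c *\<^sub>C x) = cmod c * hnorm H x"
proof -
  assume x: "x \<in> hcarrier H"
  have "hinner H (c *\<^sub>C x) (c *\<^sub>C x) = (c * cnj c) * hinner H x x"
    using x by (simp add: inner_scale_left inner_scale_right)
  also have "\<dots> = of_real ((cmod c)\<^sup>2 * (hnorm H x)\<^sup>2)"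
    using x by (simp only: inner_self complex_norm_square[symmetric] of_real_mult)
  finally have "(hnorm H (c *\<^sub>C x))\<^sup>2 = (cmod c * hnorm H x)\<^sup>2"
    using x by (simp add: hnorm_sq[of "c *\<^sub>C x"] power_mult_distrib)
  then show ?thesis using x by (simp add: power2_eq_iff_nonneg)
qed

lemma hnorm_minus_commute:
  assumes "x \<in> hcarrier H" "y \<in> hcarrier H" shows "hnorm H (x - y) = hnorm H (y - x)"
proof -
  have "x - y = (-1) *\<^sub>C (y - x)"
    by (simp add: complex_vector.scale_minus_left scaleC_one)
  then show ?thesis using assms hnorm_scale[of "y - x" "-1"] by simp
qed

lemma hnorm_add_sq:
  assumes "x \<in> hcarrier H" "y \<in> hcarrier H"
  shows "(hnorm H (x + y))\<^sup>2 = (hnorm H x)\<^sup>2 + (hnorm H y)\<^sup>2 + 2 * Re (hinner H x y)"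
  using assms inner_cnj[of x y] by (simp add: hnorm_sq inner_add_left inner_add_right)

lemma hnorm_diff_sq:
  assumes "x \<in> hcarrier H" "y \<in> hcarrier H"
  shows "(hnorm H (x - y))\<^sup>2 = (hnorm H x)\<^sup>2 + (hnorm H y)\<^sup>2 - 2 * Re (hinner H x y)"
  using assms inner_cnj[of x y] by (simp add: hnorm_sq inner_diff_left inner_diff_right)

text \<open>
  Positivity of the norm of \<open>\<parallel>y\<parallel>\<^sup>2 x - \<langle>x, y\<rangle> y\<close>; this choice avoids dividing by \<open>\<parallel>y\<parallel>\<close>.
\<close>

lemma cauchy_schwarz:
  assumes x: "x \<in> hcarrier H" and y: "y \<in> hcarrier H"
  shows "cmod (hinner H x y) \<le> hnorm H x * hnorm H y"
proof (cases "y = 0")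
  case True
  then show ?thesis using x by simp
next
  case False
  define p where "p = hinner H x y"
  define s where "s = (hnorm H y)\<^sup>2"
  have s: "s > 0" using False y by (simp add: s_def zero_less_power2)
  define v where "v = of_real s *\<^sub>C x - p *\<^sub>C y"
  have v: "v \<in> hcarrier H" using x y by (simp add: v_def)
  have ys: "hinner H y y = of_real s" using y by (simp add: inner_self s_def)
  have "hinner H v v = of_real s * (of_real s * hinner H x x) - of_real s * (cnj p * p)
      - (p * (of_real s * cnj p) - p * (cnj p * of_real s))"
    using x y unfolding v_def
    by (simp only: inner_diff_left inner_diff_right inner_scale_left inner_scale_right diff_closed
        scale_closed inner_cnj[of x y] p_def[symmetric] ys complex_cnj_complex_of_real
        right_diff_distrib, simp only: ac_simps)
  also have "\<dots> = of_real s * (of_real s * hinner H x x) - of_real s * (p * cnj p)"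
    by (simp add: ac_simps)
  also have "\<dots> = of_real (s * (s * (hnorm H x)\<^sup>2 - (cmod p)\<^sup>2))"
    using x by (simp only: inner_self complex_norm_square[symmetric] of_real_mult of_real_diff
        right_diff_distrib)
  finally have "0 \<le> s * (s * (hnorm H x)\<^sup>2 - (cmod p)\<^sup>2)"
    using inner_nonneg[OF v] by simp
  then have "(cmod p)\<^sup>2 \<le> s * (hnorm H x)\<^sup>2"
    using s by (simp add: zero_le_mult_iff)
  then have le: "(cmod p)\<^sup>2 \<le> (hnorm H x * hnorm H y)\<^sup>2"
    by (simp add: s_def power_mult_distrib mult.commute)
  show ?thesis using power2_le_imp_le[OF le] x y by (simp add: p_def)
qed

lemma hnorm_add_le:
  assumes x: "x \<in> hcarrier H" and y: "y \<in> hcarrier H"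
  shows "hnorm H (x + y) \<le> hnorm H x + hnorm H y"
proof (rule power2_le_imp_le)
  have "Re (hinner H x y) \<le> hnorm H x * hnorm H y"
    using cauchy_schwarz[OF x y] complex_Re_le_cmod order_trans by blast
  then show "(hnorm H (x + y))\<^sup>2 \<le> (hnorm H x + hnorm H y)\<^sup>2"
    using x y by (simp add: hnorm_add_sq power2_sum)
qed (use x y in simp)

lemma hnorm_diff_le:
  assumes "x \<in> hcarrier H" and "y \<in> hcarrier H"
  shows "hnorm H x - hnorm H y \<le> hnorm H (x - y)"
  using hnorm_add_le[of "x - y" y] assms by simp

lemma hnorm_triangle:
  assumes "x \<in> hcarrier H" "y \<in> hcarrier H" "z \<in> hcarrier H"
  shows "hnorm H (x - z) \<le> hnorm H (x - y) + hnorm H (y - z)"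
  using hnorm_add_le[of "x - y" "y - z"] assms by simp

lemma hnorm_sum_le:
  assumes "\<And>i. i \<in> I \<Longrightarrow> f i \<in> hcarrier H"
  shows "hnorm H (sum f I) \<le> (\<Sum>i\<in>I. hnorm H (f i))"
  using assms
proof (induction I rule: infinite_finite_induct)
  case (insert i I)
  then have "hnorm H (f i + sum f I) \<le> hnorm H (f i) + hnorm H (sum f I)"
    by (intro hnorm_add_le) auto
  with insert show ?case by (simp add: order_trans)
qed auto

lemma Metric_space_hdist: "Metric_space (hcarrier H) (hdist H)"
  by unfold_locales (auto simp: hdist_def hnorm_minus_commute intro: hnorm_triangle)

lemma limitin_iff:
  assumes "\<And>n. x n \<in> hcarrier H"
  shows "limitin (htopology H) x l sequentially
    \<longleftrightarrow> l \<in> hcarrier H \<and> (\<lambda>n. hnorm H (x n - l)) \<longlonglongrightarrow> 0"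
  using assms
  by (auto simp: htopology_def Metric_space.limitin_metric[OF Metric_space_hdist] tendsto_iff hdist_def)

lemma limit_unique:
  assumes "\<And>n. x n \<in> hcarrier H" "l \<in> hcarrier H" "m \<in> hcarrier H"
    and "(\<lambda>n. hnorm H (x n - l)) \<longlonglongrightarrow> 0" "(\<lambda>n. hnorm H (x n - m)) \<longlonglongrightarrow> 0"
  shows "l = m"
proof -
  have "hnorm H (l - m) \<le> 0"
  proof (rule LIMSEQ_le_const)
    show "(\<lambda>n. hnorm H (x n - l) + hnorm H (x n - m)) \<longlonglongrightarrow> 0"
      using tendsto_add[OF assms(4,5)] by simp
    show "\<exists>N. \<forall>n\<ge>N. hnorm H (l - m) \<le> hnorm H (x n - l) + hnorm H (x n - m)"
      using hnorm_triangle[of l _ m] assms by (metis hnorm_minus_commute)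
  qed
  then have "hnorm H (l - m) = 0"
    by (meson assms diff_closed hnorm_nonneg order_antisym)
  then show ?thesis using assms by simp
qed

lemma limit_inner:
  assumes "\<And>n. x n \<in> hcarrier H" "l \<in> hcarrier H" "y \<in> hcarrier H"
    and "(\<lambda>n. hnorm H (x n - l)) \<longlonglongrightarrow> 0"
  shows "(\<lambda>n. hinner H (x n) y) \<longlonglongrightarrow> hinner H l y"
proof (rule Lim_transform)
  show "(\<lambda>n. hinner H l y) \<longlonglongrightarrow> hinner H l y" by simp
  show "(\<lambda>n. hinner H (x n) y - hinner H l y) \<longlonglongrightarrow> 0"
  proof (rule Lim_null_comparison)
    show "(\<lambda>n. hnorm H (x n - l) * hnorm H y) \<longlonglongrightarrow> 0"
      using tendsto_mult_right[OF assms(4), of "hnorm H y"] by simp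
    show "\<forall>\<^sub>F n in sequentially. cmod (hinner H (x n) y - hinner H l y) \<le> hnorm H (x n - l) * hnorm H y"
      using assms cauchy_schwarz[of "x _ - l" y] by (intro always_eventually) (simp add: inner_diff_left)
  qed
qed

lemma limit_hnorm:
  assumes "\<And>n. x n \<in> hcarrier H" "l \<in> hcarrier H"
    and "(\<lambda>n. hnorm H (x n - l)) \<longlonglongrightarrow> 0"
  shows "(\<lambda>n. hnorm H (x n)) \<longlonglongrightarrow> hnorm H l"
proof (rule Lim_transform)
  show "(\<lambda>n. hnorm H l) \<longlonglongrightarrow> hnorm H l" by simp
  show "(\<lambda>n. hnorm H (x n) - hnorm H l) \<longlonglongrightarrow> 0"
  proof (rule Lim_null_comparison[OF _ assms(3)])
    show "\<forall>\<^sub>F n in sequentially. norm (hnorm H (x n) - hnorm H l) \<le> hnorm H (x n - l)"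
      using assms hnorm_diff_le[of "x _" l] hnorm_diff_le[of l "x _"]
      by (intro always_eventually) (auto simp: abs_le_iff hnorm_minus_commute[of _ l])
  qed
qed

text \<open>
  This is how new Hilbert spaces are recognised: the metric is eliminated in favour of the norm.
\<close>

lemma complete_iff:
  "Metric_space.mcomplete (hcarrier H) (hdist H) \<longleftrightarrow>
   (\<forall>x. (\<forall>n. x n \<in> hcarrier H) \<longrightarrow>
        (\<forall>e>0. \<exists>N. \<forall>m\<ge>N. \<forall>n\<ge>N. hnorm H (x m - x n) < e) \<longrightarrow>
        (\<exists>l\<in>hcarrier H. (\<lambda>n. hnorm H (x n - l)) \<longlonglongrightarrow> 0))"
proof -
  interpret Metric_space "hcarrier H" "hdist H" by (rule Metric_space_hdist)
  have cauchy: "MCauchy x \<longleftrightarrow> (\<forall>n. x n \<in> hcarrier H) \<and>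
        (\<forall>e>0. \<exists>N. \<forall>m\<ge>N. \<forall>n\<ge>N. hnorm H (x m - x n) < e)" for x
    unfolding MCauchy_def hdist_def image_subset_iff by auto
  have "limitin mtopology x l sequentially \<longleftrightarrow>
      l \<in> hcarrier H \<and> (\<lambda>n. hnorm H (x n - l)) \<longlonglongrightarrow> 0" if "\<forall>n. x n \<in> hcarrier H" for x l
    using limitin_iff[of x l] that by (simp add: htopology_def)
  then show ?thesis unfolding mcomplete_def cauchy by blast
qed

end

sublocale complex_hilbert_space \<subseteq> complex_inner_space H
  by unfold_locales
    (rule subspace_carrier inner_add_left inner_scale_left inner_cnj inner_nonneg inner_definite;
      assumption)+

lemma complex_hilbert_spaceI:
  assumes "complex_inner_space H"
    and "\<And>x. \<lbrakk>\<And>n. x n \<in> hcarrier H; \<And>e. e > 0 \<Longrightarrow> \<exists>N. \<forall>m\<ge>N. \<forall>n\<ge>N. hnorm H (x m - x n) < e\<rbrakk>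
        \<Longrightarrow> \<exists>l\<in>hcarrier H. (\<lambda>n. hnorm H (x n - l)) \<longlonglongrightarrow> 0"
  shows "complex_hilbert_space H"
proof -
  interpret complex_inner_space H by fact
  show ?thesis
  proof
    show "Metric_space.mcomplete (hcarrier H) (hdist H)"
      unfolding complete_iff using assms(2) by blast
  qed (rule subspace_carrier inner_add_left inner_scale_left inner_cnj inner_nonneg inner_definite;
      assumption)+
qed

context complex_hilbert_space
begin

lemma cauchy_converges:
  assumes "\<And>n. x n \<in> hcarrier H"
    and "\<And>e. e > 0 \<Longrightarrow> \<exists>N. \<forall>m\<ge>N. \<forall>n\<ge>N. hnorm H (x m - x n) < e"
  obtains l where "l \<in> hcarrier H" "(\<lambda>n. hnorm H (x n - l)) \<longlonglongrightarrow> 0"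
  using complete assms unfolding complete_iff by blast

lemma closed_subspace_limit:
  assumes "closed_subspace H M" "\<And>n. x n \<in> M" "l \<in> hcarrier H"
    and "(\<lambda>n. hnorm H (x n - l)) \<longlonglongrightarrow> 0"
  shows "l \<in> M"
proof (rule limitin_closedin)
  show "limitin (htopology H) x l sequentially"
    using assms by (subst limitin_iff) (auto simp: closed_subspace_def)
  show "closedin (htopology H) M" using assms(1) by (simp add: closed_subspace_def)
qed (use assms in auto)

text \<open>
  A minimising sequence for the distance to \<open>M\<close> is Cauchy by the parallelogram law.
\<close>

lemma projection_exists:
  assumes M: "closed_subspace H M" and x: "x \<in> hcarrier H"
  shows "\<exists>p\<in>M. \<forall>m\<in>M. hinner H (x - p) m = 0"
proof -
  have MC: "m \<in> hcarrier H" if "m \<in> M" for m using M that by (auto simp: closed_subspace_def)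
  have sub: "complex_vector.subspace M" using M by (simp add: closed_subspace_def)
  define d where "d = (INF m\<in>M. (hnorm H (x - m))\<^sup>2)"
  have M0: "0 \<in> M" using sub by (rule complex_vector.subspace_0)
  have d_le: "d \<le> (hnorm H (x - m))\<^sup>2" if "m \<in> M" for m
    unfolding d_def by (rule cINF_lower[OF _ that]) (auto intro!: bdd_belowI[of _ 0])
  have "\<exists>m. m \<in> M \<and> (hnorm H (x - m))\<^sup>2 < d + 1 / real (Suc k)" for k
  proof -
    have "Inf ((\<lambda>m. (hnorm H (x - m))\<^sup>2) ` M) < d + 1 / real (Suc k)"
      by (simp add: d_def)
    then show ?thesis using cInf_lessD[of "(\<lambda>m. (hnorm H (x - m))\<^sup>2) ` M"] M0 by blast
  qed
  then have "\<exists>m. \<forall>k. m k \<in> M \<and> (hnorm H (x - m k))\<^sup>2 < d + 1 / real (Suc k)"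
    by (intro choice allI)
  then obtain m where m: "\<And>k. m k \<in> M" "\<And>k. (hnorm H (x - m k))\<^sup>2 < d + 1 / real (Suc k)"
    by blast
  have par: "(hnorm H (m i - m j))\<^sup>2 \<le> 2 / real (Suc i) + 2 / real (Suc j)" for i j
  proof -
    define a b where "a = x - m i" and "b = x - m j"
    have ab: "a \<in> hcarrier H" "b \<in> hcarrier H" using MC m x by (auto simp: a_def b_def)
    have mid: "(1/2) *\<^sub>C (m i + m j) \<in> M"
      using sub m by (simp add: complex_vector.subspace_scale complex_vector.subspace_add)
    have "a + b = 2 *\<^sub>C (x - (1/2) *\<^sub>C (m i + m j))"
    proof -
      have "2 *\<^sub>C x = x + x" using scaleC_add_left[of 1 1 x] by (simp add: scaleC_one)
      then show ?thesis
        by (simp add: a_def b_def complex_vector.scale_right_diff_distrib scaleC_scaleC scaleC_one)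
    qed
    then have "(hnorm H (a + b))\<^sup>2 = 4 * (hnorm H (x - (1/2) *\<^sub>C (m i + m j)))\<^sup>2"
      using mid MC x by (simp add: hnorm_scale power_mult_distrib)
    then have "4 * d \<le> (hnorm H (a + b))\<^sup>2" using d_le[OF mid] by simp
    moreover have "(hnorm H (a + b))\<^sup>2 + (hnorm H (a - b))\<^sup>2 = 2 * (hnorm H a)\<^sup>2 + 2 * (hnorm H b)\<^sup>2"
      using ab by (simp add: hnorm_add_sq hnorm_diff_sq)
    moreover have "(hnorm H (a - b))\<^sup>2 = (hnorm H (m i - m j))\<^sup>2"
      using hnorm_minus_commute[of "m j" "m i"] MC m by (simp add: a_def b_def)
    moreover have two: "2 / real (Suc k) = 2 * (1 / real (Suc k))" for k by simp
    ultimately show ?thesis using m(2)[of i] m(2)[of j] two[of i] two[of j]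
      unfolding a_def b_def by linarith
  qed
  obtain p where p: "p \<in> hcarrier H" "(\<lambda>k. hnorm H (m k - p)) \<longlonglongrightarrow> 0"
  proof (rule cauchy_converges)
    fix e :: real assume e: "e > 0"
    obtain N where N: "4 / e\<^sup>2 < real N" using reals_Archimedean2 by blast
    have "hnorm H (m i - m j) < e" if "i \<ge> N" "j \<ge> N" for i j
    proof (rule power2_less_imp_less)
      have N0: "real N > 0" using N e by (intro less_trans[OF _ N]) simp
      have "(hnorm H (m i - m j))\<^sup>2 \<le> 2 / real N + 2 / real N"
        using that N0 by (intro order_trans[OF par] add_mono divide_left_mono) auto
      also have "\<dots> < e\<^sup>2" using N N0 e by (simp add: field_simps)
      finally show "(hnorm H (m i - m j))\<^sup>2 < e\<^sup>2" .
    qed (use e in simp)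
    then show "\<exists>N. \<forall>i\<ge>N. \<forall>j\<ge>N. hnorm H (m i - m j) < e" by blast
  qed (use MC m in auto)
  have pM: "p \<in> M" using closed_subspace_limit[OF M _ p] m by auto
  have lim: "(\<lambda>k. (hnorm H (x - m k))\<^sup>2) \<longlonglongrightarrow> (hnorm H (x - p))\<^sup>2"
  proof (intro tendsto_power limit_hnorm)
    show "(\<lambda>n. hnorm H (x - m n - (x - p))) \<longlonglongrightarrow> 0"
      using p MC m by (simp add: hnorm_minus_commute[of p])
  qed (use MC m x p in auto)
  have "(hnorm H (x - p))\<^sup>2 \<le> d"
  proof (rule LIMSEQ_le[OF lim])
    show "(\<lambda>k. d + 1 / real (Suc k)) \<longlonglongrightarrow> d"
      using tendsto_add[OF tendsto_const LIMSEQ_inverse_real_of_nat, of d] by (simp add: field_simps)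
  qed (use m less_imp_le in blast)
  then have min: "(hnorm H (x - p))\<^sup>2 \<le> (hnorm H (x - q))\<^sup>2" if "q \<in> M" for q
    using d_le[OF that] by simp
  have "hinner H (x - p) v = 0" if v: "v \<in> M" for v
  proof (cases "v = 0")
    case False
    define c where "c = hinner H (x - p) v"
    define s where "s = (hnorm H v)\<^sup>2"
    have s: "s > 0" using False MC[OF v] by (simp add: s_def)
    have q: "p + (c / of_real s) *\<^sub>C v \<in> M"
      using sub pM v by (simp add: complex_vector.subspace_scale complex_vector.subspace_add)
    have "(hnorm H (x - p))\<^sup>2 \<le> (hnorm H ((x - p) - (c / of_real s) *\<^sub>C v))\<^sup>2"
      using min[OF q] by (simp add: diff_diff_eq)
    also have "\<dots> = (hnorm H (x - p))\<^sup>2 + (cmod c / s)\<^sup>2 * s - 2 * Re (cnj (c / of_real s) * c)"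
      using MC[OF v] x p s
      by (simp add: hnorm_diff_sq hnorm_scale inner_scale_right power_mult_distrib power_divide norm_divide
          c_def[symmetric] s_def[symmetric])
    also have "cnj (c / of_real s) * c = of_real ((cmod c)\<^sup>2 / s)"
      unfolding of_real_divide complex_norm_square by simp
    finally have "(cmod c)\<^sup>2 / s \<le> 0" using s by (simp add: power2_eq_square)
    then show ?thesis using s by (simp add: c_def divide_le_0_iff)
  qed (use x p in simp)
  then show ?thesis using pM by blast
qed

end


section \<open>Construction of Hilbert spaces\<close>

lemma (in complex_hilbert_space) closed_subspace_hilbert:
  assumes M: "closed_subspace H M"
  shows "complex_hilbert_space (H\<lparr>hcarrier := M\<rparr>)"
proof (rule complex_hilbert_spaceI)
  have MC: "m \<in> hcarrier H" if "m \<in> M" for m using M that by (auto simp: closed_subspace_def)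
  have sub: "complex_vector.subspace M" using M by (simp add: closed_subspace_def)
  show "complex_inner_space (H\<lparr>hcarrier := M\<rparr>)"
  proof
    fix x y assume "x \<in> hcarrier (H\<lparr>hcarrier := M\<rparr>)" "y \<in> hcarrier (H\<lparr>hcarrier := M\<rparr>)"
    then have "hinner H y x = cnj (hinner H x y)" by (intro inner_cnj) (auto simp: MC)
    then show "hinner (H\<lparr>hcarrier := M\<rparr>) y x = cnj (hinner (H\<lparr>hcarrier := M\<rparr>) x y)" by simp
  qed (auto simp: MC sub inner_add_left inner_scale_left inner_nonneg intro: inner_definite)
  fix x :: "nat \<Rightarrow> _"
  assume x: "\<And>n. x n \<in> hcarrier (H\<lparr>hcarrier := M\<rparr>)"
    and cauchy: "\<And>e. e > 0 \<Longrightarrow> \<exists>N. \<forall>m\<ge>N. \<forall>n\<ge>N. hnorm (H\<lparr>hcarrier := M\<rparr>) (x m - x n) < e"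
  have nrm: "hnorm (H\<lparr>hcarrier := M\<rparr>) v = hnorm H v" for v by (simp add: hnorm_def)
  have xM: "x n \<in> M" for n using x[of n] by simp
  obtain l where l: "l \<in> hcarrier H" "(\<lambda>n. hnorm H (x n - l)) \<longlonglongrightarrow> 0"
    by (rule cauchy_converges[of x]) (use xM MC cauchy nrm in auto)
  then have "l \<in> M" using closed_subspace_limit[OF M xM] by simp
  then show "\<exists>l\<in>hcarrier (H\<lparr>hcarrier := M\<rparr>). (\<lambda>n. hnorm (H\<lparr>hcarrier := M\<rparr>) (x n - l)) \<longlonglongrightarrow> 0"
    using l by (auto simp: nrm)
qed

lemma complex_hilbert_space_isomorphic:
  assumes H: "complex_hilbert_space H"
    and surj: "f ` hcarrier H = hcarrier K"
    and add: "\<And>x y. \<lbrakk>x \<in> hcarrier H; y \<in> hcarrier H\<rbrakk> \<Longrightarrow> f (x + y) = f x + f y"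
    and scale: "\<And>c x. x \<in> hcarrier H \<Longrightarrow> f (c *\<^sub>C x) = c *\<^sub>C f x"
    and inner: "\<And>x y. \<lbrakk>x \<in> hcarrier H; y \<in> hcarrier H\<rbrakk> \<Longrightarrow> hinner K (f x) (f y) = hinner H x y"
  shows "complex_hilbert_space K"
proof (rule complex_hilbert_spaceI)
  interpret H: complex_hilbert_space H by fact
  have im: "x \<in> hcarrier K \<longleftrightarrow> (\<exists>y\<in>hcarrier H. x = f y)" for x using surj by auto
  have f0: "f 0 = 0" using add[of 0 0] by simp
  have diff: "f (x - y) = f x - f y" if "x \<in> hcarrier H" "y \<in> hcarrier H" for x y
    using add[of "x - y" y] that by (simp add: algebra_simps)
  have norm: "hnorm K (f x) = hnorm H x" if "x \<in> hcarrier H" for x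
    using that by (simp add: hnorm_def inner)
  show "complex_inner_space K"
  proof
    show "complex_vector.subspace (hcarrier K)"
      unfolding complex_vector.subspace_def surj[symmetric]
    proof (intro conjI ballI allI)
      show "0 \<in> f ` hcarrier H" using f0 H.zero_closed by (metis image_eqI)
      fix x y c assume x: "x \<in> f ` hcarrier H"
      show "c *\<^sub>C x \<in> f ` hcarrier H" using x by (auto simp: scale[symmetric])
      assume "y \<in> f ` hcarrier H"
      with x show "x + y \<in> f ` hcarrier H" by (auto simp: add[symmetric])
    qed
  next
    fix x y assume "x \<in> hcarrier K" "y \<in> hcarrier K"
    then obtain a b where "a \<in> hcarrier H" "b \<in> hcarrier H" "x = f a" "y = f b"
      by (auto simp: im)
    then show "hinner K y x = cnj (hinner K x y)" using H.inner_cnj[of a b] by (simp add: inner)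
  next
    fix x assume "x \<in> hcarrier K" "hinner K x x = 0"
    moreover from this obtain a where "a \<in> hcarrier H" "x = f a" by (auto simp: im)
    ultimately show "x = 0" using H.inner_definite[of a] f0 by (simp add: inner)
  qed (auto simp: im inner add[symmetric] scale[symmetric] H.inner_add_left H.inner_scale_left H.inner_nonneg)
  fix x :: "nat \<Rightarrow> _"
  assume x: "\<And>n. x n \<in> hcarrier K"
    and cauchy: "\<And>e. e > 0 \<Longrightarrow> \<exists>N. \<forall>m\<ge>N. \<forall>n\<ge>N. hnorm K (x m - x n) < e"
  have "\<exists>y. \<forall>n. y n \<in> hcarrier H \<and> x n = f (y n)"
    using x unfolding im by (intro choice) blast
  then obtain y where y: "\<And>n. y n \<in> hcarrier H" "\<And>n. x n = f (y n)" by blast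
  obtain l where l: "l \<in> hcarrier H" "(\<lambda>n. hnorm H (y n - l)) \<longlonglongrightarrow> 0"
    by (rule H.cauchy_converges[of y])
      (use y cauchy in \<open>auto simp: diff[symmetric] norm\<close>)
  then show "\<exists>l\<in>hcarrier K. (\<lambda>n. hnorm K (x n - l)) \<longlonglongrightarrow> 0"
    using y by (intro bexI[of _ "f l"]) (auto simp: im diff[symmetric] norm)
qed

lemma complex_inner_space_direct_sum:
  assumes J: "finite J" and H: "\<And>j. j \<in> J \<Longrightarrow> complex_inner_space (H j)"
  shows "complex_inner_space (direct_sum J H)"
proof
  have car: "x \<in> hcarrier (direct_sum J H) \<longleftrightarrow> (\<forall>j\<in>J. x j \<in> hcarrier (H j)) \<and> (\<forall>j. j \<notin> J \<longrightarrow> x j = 0)" for x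
    by (simp add: direct_sum_def)
  have inn: "hinner (direct_sum J H) x y = (\<Sum>j\<in>J. hinner (H j) (x j) (y j))" for x y
    by (simp add: direct_sum_def)
  note closed = complex_inner_space.zero_closed[OF H] complex_inner_space.add_closed[OF H]
    complex_inner_space.scale_closed[OF H]
  show "complex_vector.subspace (hcarrier (direct_sum J H))"
    unfolding complex_vector.subspace_def
    by (auto simp: car closed scaleC_fun_def)
  fix x y z c assume x: "x \<in> hcarrier (direct_sum J H)"
  show "0 \<le> Re (hinner (direct_sum J H) x x)"
    using x complex_inner_space.inner_nonneg[OF H] by (simp add: inn car sum_nonneg)
  { assume 0: "hinner (direct_sum J H) x x = 0"
    have "(\<Sum>j\<in>J. Re (hinner (H j) (x j) (x j))) = 0"
      using arg_cong[OF 0, of Re] by (simp add: inn)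
    then have "\<forall>j\<in>J. Re (hinner (H j) (x j) (x j)) = 0"
      using x J complex_inner_space.inner_nonneg[OF H] by (subst (asm) sum_nonneg_eq_0_iff) (auto simp: car)
    then have "\<forall>j\<in>J. hinner (H j) (x j) (x j) = 0"
      using x complex_inner_space.inner_self[OF H] by (auto simp: car)
    then have "x j = 0" for j
      using x complex_inner_space.inner_definite[OF H, of j "x j"] by (cases "j \<in> J") (auto simp: car)
    then show "x = 0" by (simp add: fun_eq_iff) }
  assume y: "y \<in> hcarrier (direct_sum J H)"
  show "hinner (direct_sum J H) (c *\<^sub>C x) y = c * hinner (direct_sum J H) x y"
    using x y complex_inner_space.inner_scale_left[OF H]
    by (simp add: inn car scaleC_fun_def sum_distrib_left)
  have "hinner (H j) (y j) (x j) = cnj (hinner (H j) (x j) (y j))" if "j \<in> J" for j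
    using x y complex_inner_space.inner_cnj[OF H[OF that], of "x j" "y j"] that by (auto simp: car)
  then show "hinner (direct_sum J H) y x = cnj (hinner (direct_sum J H) x y)"
    by (simp add: inn)
  assume z: "z \<in> hcarrier (direct_sum J H)"
  show "hinner (direct_sum J H) (x + y) z = hinner (direct_sum J H) x z + hinner (direct_sum J H) y z"
    using x y z complex_inner_space.inner_add_left[OF H] by (simp add: inn car sum.distrib)
qed

text \<open>
  Zero weights are allowed, and coordinates of weight zero have to vanish so that the inner
  product stays definite. A weight with finite support gives a finite direct sum.
\<close>

definition weighted_l2 :: "(nat \<Rightarrow> real) \<Rightarrow> 'v::complex_vector hilbert \<Rightarrow> (nat \<Rightarrow> 'v) hilbert" where
  "weighted_l2 w H =
     \<lparr>hcarrier = {a. (\<forall>j. a j \<in> hcarrier H) \<and> (\<forall>j. w j = 0 \<longrightarrow> a j = 0) \<and>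
                     summable (\<lambda>j. w j * (hnorm H (a j))\<^sup>2)},
      hinner = (\<lambda>a b. \<Sum>j. of_real (w j) * hinner H (a j) (b j))\<rparr>"

lemma weighted_l2_carrier:
  "a \<in> hcarrier (weighted_l2 w H) \<longleftrightarrow>
    (\<forall>j. a j \<in> hcarrier H) \<and> (\<forall>j. w j = 0 \<longrightarrow> a j = 0) \<and> summable (\<lambda>j. w j * (hnorm H (a j))\<^sup>2)"
  by (simp add: weighted_l2_def)

lemma weighted_l2_inner:
  "hinner (weighted_l2 w H) a b = (\<Sum>j. of_real (w j) * hinner H (a j) (b j))"
  by (simp add: weighted_l2_def)

context complex_inner_space
begin

lemma weighted_l2_summable:
  assumes w: "\<And>j. w j \<ge> 0" and a: "a \<in> hcarrier (weighted_l2 w H)" and b: "b \<in> hcarrier (weighted_l2 w H)"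
  shows "summable (\<lambda>j. of_real (w j) * hinner H (a j) (b j))"
proof (rule summable_comparison_test')
  show "summable (\<lambda>j. w j * (hnorm H (a j))\<^sup>2 + w j * (hnorm H (b j))\<^sup>2)"
    using a b by (intro summable_add) (auto simp: weighted_l2_carrier)
  fix j :: nat
  have aj: "a j \<in> hcarrier H" "b j \<in> hcarrier H" using a b by (auto simp: weighted_l2_carrier)
  have "hnorm H (a j) * hnorm H (b j) \<le> (hnorm H (a j))\<^sup>2 + (hnorm H (b j))\<^sup>2"
    using sum_squares_bound[of "hnorm H (a j)" "hnorm H (b j)"] mult_nonneg_nonneg[OF hnorm_nonneg hnorm_nonneg, OF aj]
    by linarith
  then have "cmod (hinner H (a j) (b j)) \<le> (hnorm H (a j))\<^sup>2 + (hnorm H (b j))\<^sup>2"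
    using cauchy_schwarz[OF aj] by linarith
  then have "w j * cmod (hinner H (a j) (b j)) \<le> w j * ((hnorm H (a j))\<^sup>2 + (hnorm H (b j))\<^sup>2)"
    using w by (rule mult_left_mono)
  then show "norm (of_real (w j) * hinner H (a j) (b j)) \<le> w j * (hnorm H (a j))\<^sup>2 + w j * (hnorm H (b j))\<^sup>2"
    using w[of j] by (simp add: norm_mult distrib_left)
qed

lemma weighted_l2_inner_self:
  assumes w: "\<And>j. w j \<ge> 0" and a: "a \<in> hcarrier (weighted_l2 w H)"
  shows "hinner (weighted_l2 w H) a a = of_real (\<Sum>j. w j * (hnorm H (a j))\<^sup>2)"
proof -
  have "of_real (w j) * hinner H (a j) (a j) = of_real (w j * (hnorm H (a j))\<^sup>2)" for j
    using a by (simp add: weighted_l2_carrier inner_self)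
  moreover have "summable (\<lambda>j. w j * (hnorm H (a j))\<^sup>2)" using a by (simp add: weighted_l2_carrier)
  ultimately show ?thesis unfolding weighted_l2_inner by (simp only: suminf_of_real)
qed

lemma weighted_l2_hnorm:
  assumes w: "\<And>j. w j \<ge> 0" and a: "a \<in> hcarrier (weighted_l2 w H)"
  shows "(hnorm (weighted_l2 w H) a)\<^sup>2 = (\<Sum>j. w j * (hnorm H (a j))\<^sup>2)"
proof -
  have "(\<Sum>j. w j * (hnorm H (a j))\<^sup>2) \<ge> 0"
    using a w by (intro suminf_nonneg) (auto simp: weighted_l2_carrier)
  then show ?thesis unfolding hnorm_def[of "weighted_l2 w H"] by (simp add: weighted_l2_inner_self[OF w a])
qed

lemma weighted_l2_coordinate_le:
  assumes w: "\<And>j. w j \<ge> 0" and a: "a \<in> hcarrier (weighted_l2 w H)"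
  shows "w j * (hnorm H (a j))\<^sup>2 \<le> (hnorm (weighted_l2 w H) a)\<^sup>2"
  unfolding weighted_l2_hnorm[OF w a]
  using sum_le_suminf[of "\<lambda>j. w j * (hnorm H (a j))\<^sup>2" "{j}"] a w by (auto simp: weighted_l2_carrier)

lemma complex_inner_space_weighted_l2:
  assumes w: "\<And>j. w j \<ge> 0"
  shows "complex_inner_space (weighted_l2 w H)"
proof
  let ?L = "weighted_l2 w H"
  have zero: "0 \<in> hcarrier ?L" by (simp add: weighted_l2_carrier)
  have scale: "c *\<^sub>C a \<in> hcarrier ?L" if "a \<in> hcarrier ?L" for a c
  proof -
    have "summable (\<lambda>j. (cmod c)\<^sup>2 * (w j * (hnorm H (a j))\<^sup>2))"
      using that by (intro summable_mult) (simp add: weighted_l2_carrier)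
    then show ?thesis using that
      by (auto simp: weighted_l2_carrier scaleC_fun_def hnorm_scale power_mult_distrib ac_simps)
  qed
  have add: "a + b \<in> hcarrier ?L" if a: "a \<in> hcarrier ?L" and b: "b \<in> hcarrier ?L" for a b
  proof -
    have "summable (\<lambda>j. w j * (hnorm H (a j + b j))\<^sup>2)"
    proof (rule summable_comparison_test')
      show "summable (\<lambda>j. 2 * (w j * (hnorm H (a j))\<^sup>2) + 2 * (w j * (hnorm H (b j))\<^sup>2))"
        using a b by (intro summable_add summable_mult) (auto simp: weighted_l2_carrier)
      fix j :: nat
      have "a j \<in> hcarrier H" "b j \<in> hcarrier H" using a b by (auto simp: weighted_l2_carrier)
      then have "(hnorm H (a j + b j))\<^sup>2 + (hnorm H (a j - b j))\<^sup>2 = 2 * (hnorm H (a j))\<^sup>2 + 2 * (hnorm H (b j))\<^sup>2"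
        by (simp add: hnorm_add_sq hnorm_diff_sq)
      then have "(hnorm H (a j + b j))\<^sup>2 \<le> 2 * (hnorm H (a j))\<^sup>2 + 2 * (hnorm H (b j))\<^sup>2"
        using zero_le_power2[of "hnorm H (a j - b j)"] by linarith
      from mult_left_mono[OF this w[of j]]
      show "norm (w j * (hnorm H (a j + b j))\<^sup>2) \<le> 2 * (w j * (hnorm H (a j))\<^sup>2) + 2 * (w j * (hnorm H (b j))\<^sup>2)"
        using w[of j] by (simp add: algebra_simps)
    qed
    then show ?thesis using a b by (auto simp: weighted_l2_carrier)
  qed
  show "complex_vector.subspace (hcarrier ?L)"
    unfolding complex_vector.subspace_def using zero scale add by blast
  fix a b d :: "nat \<Rightarrow> 'v" and c :: complex
  assume a: "a \<in> hcarrier ?L"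
  then have aj: "a j \<in> hcarrier H" for j by (simp add: weighted_l2_carrier)
  have "0 \<le> (\<Sum>j. w j * (hnorm H (a j))\<^sup>2)"
    using a w by (intro suminf_nonneg) (auto simp: weighted_l2_carrier)
  then show "0 \<le> Re (hinner ?L a a)" by (simp add: weighted_l2_inner_self[OF w a])
  { assume 0: "hinner ?L a a = 0"
    have "(\<Sum>j. w j * (hnorm H (a j))\<^sup>2) = 0"
      using 0 unfolding weighted_l2_inner_self[OF w a] by simp
    then have "\<forall>j. w j * (hnorm H (a j))\<^sup>2 = 0"
      using a w by (subst (asm) suminf_eq_zero_iff) (auto simp: weighted_l2_carrier)
    then show "a = 0" using a by (auto simp: weighted_l2_carrier fun_eq_iff) }
  assume b: "b \<in> hcarrier ?L"
  then have bj: "b j \<in> hcarrier H" for j by (simp add: weighted_l2_carrier)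
  note sab = weighted_l2_summable[OF w a b]
  show "hinner ?L (c *\<^sub>C a) b = c * hinner ?L a b"
    unfolding weighted_l2_inner scaleC_fun_def
    by (simp add: inner_scale_left aj bj suminf_mult[OF sab, symmetric] ac_simps)
  show "hinner ?L b a = cnj (hinner ?L a b)"
    unfolding weighted_l2_inner using sums_unique[OF sums_cnj[THEN iffD2, OF summable_sums[OF sab]]]
    by (simp add: inner_cnj[OF aj bj])
  assume d: "d \<in> hcarrier ?L"
  then have dj: "d j \<in> hcarrier H" for j by (simp add: weighted_l2_carrier)
  show "hinner ?L (a + b) d = hinner ?L a d + hinner ?L b d"
    unfolding weighted_l2_inner
    by (subst suminf_add[OF weighted_l2_summable[OF w a d] weighted_l2_summable[OF w b d]])
      (simp add: inner_add_left aj bj dj distrib_left)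
qed

end

text \<open>
  A Cauchy sequence converges in each coordinate. Partial sums of the norm series pass to the
  limit, which turns the Cauchy estimate into convergence in norm.
\<close>

lemma complex_hilbert_space_weighted_l2:
  assumes H: "complex_hilbert_space H" and w: "\<And>j. w j \<ge> 0"
  shows "complex_hilbert_space (weighted_l2 w H)"
proof (rule complex_hilbert_spaceI)
  interpret H: complex_hilbert_space H by fact
  let ?L = "weighted_l2 w H"
  show "complex_inner_space ?L" by (rule H.complex_inner_space_weighted_l2[OF w])
  then interpret L: complex_inner_space ?L .
  fix x :: "nat \<Rightarrow> nat \<Rightarrow> _"
  assume x: "\<And>n. x n \<in> hcarrier ?L"
    and cauchy: "\<And>e. e > 0 \<Longrightarrow> \<exists>N. \<forall>m\<ge>N. \<forall>n\<ge>N. hnorm ?L (x m - x n) < e"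
  have xj: "x n j \<in> hcarrier H" for n j using x[of n] by (simp add: weighted_l2_carrier)
  have xw: "x n j = 0" if "w j = 0" for n j using x[of n] that by (simp add: weighted_l2_carrier)
  have "\<exists>l\<in>hcarrier H. (\<lambda>n. hnorm H (x n j - l)) \<longlonglongrightarrow> 0 \<and> (w j = 0 \<longrightarrow> l = 0)" for j
  proof (cases "w j = 0")
    case True
    then show ?thesis using xw by (intro bexI[of _ 0]) auto
  next
    case False
    then have wj: "w j > 0" using w[of j] by simp
    obtain l where "l \<in> hcarrier H" "(\<lambda>n. hnorm H (x n j - l)) \<longlonglongrightarrow> 0"
    proof (rule H.cauchy_converges[of "\<lambda>n. x n j"])
      fix e :: real assume e: "e > 0"
      obtain N where N: "\<And>m n. m \<ge> N \<Longrightarrow> n \<ge> N \<Longrightarrow> hnorm ?L (x m - x n) < sqrt (w j) * e"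
        using cauchy[of "sqrt (w j) * e"] e wj by auto
      have "hnorm H (x m j - x n j) < e" if mn: "m \<ge> N" "n \<ge> N" for m n
      proof (rule power2_less_imp_less)
        have "w j * (hnorm H (x m j - x n j))\<^sup>2 \<le> (hnorm ?L (x m - x n))\<^sup>2"
          using H.weighted_l2_coordinate_le[OF w L.diff_closed[OF x[of m] x[of n]], of j] by simp
        also have "\<dots> < (sqrt (w j) * e)\<^sup>2"
          using N[OF mn] L.hnorm_nonneg[OF L.diff_closed[OF x[of m] x[of n]]]
          by (intro power_strict_mono) auto
        also have "\<dots> = w j * e\<^sup>2" using wj by (simp add: power_mult_distrib)
        finally show "(hnorm H (x m j - x n j))\<^sup>2 < e\<^sup>2" using wj by simp
      qed (use e in simp)
      then show "\<exists>N. \<forall>m\<ge>N. \<forall>n\<ge>N. hnorm H (x m j - x n j) < e" by blast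
    qed (use xj in auto)
    then show ?thesis using False by auto
  qed
  then have "\<exists>l. \<forall>j. l j \<in> hcarrier H \<and> (\<lambda>n. hnorm H (x n j - l j)) \<longlonglongrightarrow> 0 \<and> (w j = 0 \<longrightarrow> l j = 0)"
    by (intro choice) blast
  then obtain l where l: "\<And>j. l j \<in> hcarrier H" "\<And>j. (\<lambda>n. hnorm H (x n j - l j)) \<longlonglongrightarrow> 0"
    "\<And>j. w j = 0 \<Longrightarrow> l j = 0" by blast
  \<comment> \<open>The Cauchy estimate survives the limit \<open>n \<rightarrow> \<infinity>\<close> in each partial sum.\<close>
  have tail: "x m - l \<in> hcarrier ?L \<and> hnorm ?L (x m - l) \<le> e"
    if e: "e > 0" and N: "\<And>m n. m \<ge> N \<Longrightarrow> n \<ge> N \<Longrightarrow> hnorm ?L (x m - x n) < e" and m: "m \<ge> N" for m N e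
  proof -
    have part: "(\<Sum>j<J. w j * (hnorm H (x m j - l j))\<^sup>2) \<le> e\<^sup>2" for J
    proof (rule LIMSEQ_le_const2)
      have "(\<lambda>n. hnorm H (x m j - x n j)) \<longlonglongrightarrow> hnorm H (x m j - l j)" for j
        by (rule H.limit_hnorm) (use xj l H.hnorm_minus_commute in auto)
      then show "(\<lambda>n. \<Sum>j<J. w j * (hnorm H (x m j - x n j))\<^sup>2) \<longlonglongrightarrow> (\<Sum>j<J. w j * (hnorm H (x m j - l j))\<^sup>2)"
        by (intro tendsto_intros)
      have "(\<Sum>j<J. w j * (hnorm H (x m j - x n j))\<^sup>2) \<le> e\<^sup>2" if n: "n \<ge> N" for n
      proof -
        have d: "x m - x n \<in> hcarrier ?L" using x by simp
        have "(\<Sum>j<J. w j * (hnorm H ((x m - x n) j))\<^sup>2) \<le> (hnorm ?L (x m - x n))\<^sup>2"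
          unfolding H.weighted_l2_hnorm[OF w d] using d w
          by (intro sum_le_suminf) (auto simp: weighted_l2_carrier)
        also have "\<dots> \<le> e\<^sup>2"
          using N[OF m n] L.hnorm_nonneg[OF d] by (intro power_mono) auto
        finally show ?thesis by simp
      qed
      then show "\<exists>N. \<forall>n\<ge>N. (\<Sum>j<J. w j * (hnorm H (x m j - x n j))\<^sup>2) \<le> e\<^sup>2" by blast
    qed
    have sm: "summable (\<lambda>j. w j * (hnorm H (x m j - l j))\<^sup>2)"
      by (rule bounded_imp_summable[of _ "e\<^sup>2"])
        (use w part[of "Suc _"] in \<open>auto simp: lessThan_Suc_atMost\<close>)
    then have mem: "x m - l \<in> hcarrier ?L"
      using xj l xw by (auto simp: weighted_l2_carrier)
    have le: "(hnorm ?L (x m - l))\<^sup>2 \<le> e\<^sup>2"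
      unfolding H.weighted_l2_hnorm[OF w mem] using suminf_le_const[OF sm part] by simp
    show ?thesis using mem e power2_le_imp_le[OF le] by simp
  qed
  obtain N1 where "\<And>m n. m \<ge> N1 \<Longrightarrow> n \<ge> N1 \<Longrightarrow> hnorm ?L (x m - x n) < 1"
    using cauchy[of 1] by auto
  then have "x N1 - l \<in> hcarrier ?L" using tail[of 1 N1 N1] by simp
  from L.diff_closed[OF x[of N1] this] have lL: "l \<in> hcarrier ?L" by simp
  have "(\<lambda>n. hnorm ?L (x n - l)) \<longlonglongrightarrow> 0"
  proof (rule LIMSEQ_I)
    fix e :: real assume e: "e > 0"
    obtain N where N: "\<And>m n. m \<ge> N \<Longrightarrow> n \<ge> N \<Longrightarrow> hnorm ?L (x m - x n) < e / 2"
      using cauchy[of "e / 2"] e by auto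
    have "norm (hnorm ?L (x n - l) - 0) < e" if "n \<ge> N" for n
      using tail[OF _ N that] L.hnorm_nonneg[OF L.diff_closed[OF x[of n] lL]] e by simp
    then show "\<exists>N. \<forall>n\<ge>N. norm (hnorm ?L (x n - l) - 0) < e" by blast
  qed
  then show "\<exists>l\<in>hcarrier ?L. (\<lambda>n. hnorm ?L (x n - l)) \<longlonglongrightarrow> 0" using lL by blast
qed


section \<open>Operators with an adjoint\<close>

text \<open>
  The operators of the construction are given together with their adjoints. Having an adjoint
  already forces linearity, and a bound on the adjoint gives a bound on the operator.
\<close>

definition adjoint_pair ::
  "'u::complex_vector hilbert \<Rightarrow> 'v::complex_vector hilbert \<Rightarrow> ('u \<Rightarrow> 'v) \<Rightarrow> ('v \<Rightarrow> 'u) \<Rightarrow> bool" where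
  "adjoint_pair H K T T' \<longleftrightarrow>
     (\<forall>x\<in>hcarrier H. T x \<in> hcarrier K) \<and> (\<forall>y\<in>hcarrier K. T' y \<in> hcarrier H) \<and>
     (\<forall>x\<in>hcarrier H. \<forall>y\<in>hcarrier K. hinner K (T x) y = hinner H x (T' y))"

lemma adjoint_pair_closed:
  "adjoint_pair H K T T' \<Longrightarrow> x \<in> hcarrier H \<Longrightarrow> T x \<in> hcarrier K"
  "adjoint_pair H K T T' \<Longrightarrow> y \<in> hcarrier K \<Longrightarrow> T' y \<in> hcarrier H"
  by (simp_all add: adjoint_pair_def)

lemma adjoint_pair_inner:
  "adjoint_pair H K T T' \<Longrightarrow> x \<in> hcarrier H \<Longrightarrow> y \<in> hcarrier K \<Longrightarrow>
    hinner K (T x) y = hinner H x (T' y)"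
  by (simp add: adjoint_pair_def)

lemma adjoint_pair_compose:
  "adjoint_pair H K T T' \<Longrightarrow> adjoint_pair K L S S' \<Longrightarrow> adjoint_pair H L (S \<circ> T) (T' \<circ> S')"
  by (simp add: adjoint_pair_def)

lemma adjoint_pair_id: "adjoint_pair H H id id"
  by (simp add: adjoint_pair_def)

lemma adjoint_pair_funpow:
  assumes "adjoint_pair H H T T'" shows "adjoint_pair H H (T ^^ k) (T' ^^ k)"
proof (induction k)
  case 0
  show ?case using adjoint_pair_id by (simp add: id_def)
next
  case (Suc k)
  show ?case using adjoint_pair_compose[OF Suc assms]
    by (simp only: funpow_Suc_right[of k T'] funpow.simps(2)[of k T])
qed

locale adjoint_operators = dom: complex_inner_space H + cod: complex_inner_space K
  for H :: "'u::complex_vector hilbert" and K :: "'v::complex_vector hilbert" +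
  fixes T :: "'u \<Rightarrow> 'v" and T' :: "'v \<Rightarrow> 'u"
  assumes adj: "adjoint_pair H K T T'"
begin

lemmas closed = adjoint_pair_closed[OF adj]
lemmas inner = adjoint_pair_inner[OF adj]

text \<open>
  The difference of the two sides is orthogonal to everything, in particular to itself.
\<close>

lemma additive:
  assumes x: "x \<in> hcarrier H" and y: "y \<in> hcarrier H"
  shows "T (x + y) = T x + T y"
proof -
  define v where "v = T (x + y) - (T x + T y)"
  have v: "v \<in> hcarrier K" using x y closed by (simp add: v_def)
  have "hinner K v v = hinner K (T (x + y)) v - (hinner K (T x) v + hinner K (T y) v)"
    using x y closed v
    by (subst v_def) (simp add: cod.inner_diff_left cod.inner_add_left)
  also have "\<dots> = 0" using x y v closed by (simp add: inner dom.inner_add_left)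
  finally have "v = 0" using cod.inner_definite[OF v] by simp
  then show ?thesis by (simp add: v_def)
qed

lemma homogeneous:
  assumes x: "x \<in> hcarrier H"
  shows "T (c *\<^sub>C x) = c *\<^sub>C T x"
proof -
  define v where "v = T (c *\<^sub>C x) - c *\<^sub>C T x"
  have v: "v \<in> hcarrier K" using x closed by (simp add: v_def)
  have "hinner K v v = hinner K (T (c *\<^sub>C x)) v - c * hinner K (T x) v"
    using x closed v
    by (subst v_def) (simp add: cod.inner_diff_left cod.inner_scale_left)
  also have "\<dots> = 0" using x v closed by (simp add: inner dom.inner_scale_left)
  finally have "v = 0" using cod.inner_definite[OF v] by simp
  then show ?thesis by (simp add: v_def)
qed

lemma zero: "T 0 = 0"
  using additive[of 0 0] by simp

lemma diff: "x \<in> hcarrier H \<Longrightarrow> y \<in> hcarrier H \<Longrightarrow> T (x - y) = T x - T y"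
  using additive[of "x - y" y] by (simp add: eq_diff_eq)

lemma contractive:
  assumes "\<And>y. y \<in> hcarrier K \<Longrightarrow> hnorm H (T' y) \<le> hnorm K y" and x: "x \<in> hcarrier H"
  shows "hnorm K (T x) \<le> hnorm H x"
proof -
  have Tx: "T x \<in> hcarrier K" using x closed by simp
  have "(hnorm K (T x))\<^sup>2 = Re (hinner H x (T' (T x)))"
    using x Tx by (simp add: cod.hnorm_sq inner)
  also have "\<dots> \<le> hnorm H x * hnorm H (T' (T x))"
    using dom.cauchy_schwarz[OF x closed(2)[OF Tx]] complex_Re_le_cmod order_trans by blast
  also have "\<dots> \<le> hnorm H x * hnorm K (T x)"
    using assms Tx by (intro mult_left_mono) auto
  finally have le: "hnorm K (T x) * hnorm K (T x) \<le> hnorm H x * hnorm K (T x)"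
    by (simp add: power2_eq_square)
  show ?thesis
  proof (cases "hnorm K (T x) = 0")
    case True
    then show ?thesis using x by simp
  next
    case False
    then have "hnorm K (T x) > 0" using cod.hnorm_nonneg[OF Tx] by linarith
    then show ?thesis using le by simp
  qed
qed

lemma bounded:
  assumes "\<And>y. y \<in> hcarrier K \<Longrightarrow> hnorm H (T' y) \<le> hnorm K y"
  shows "T \<in> bounded_operators H K"
  unfolding bounded_operators_def
  using closed additive homogeneous contractive[OF assms] by (auto intro!: exI[of _ 1])

text \<open>
  If \<open>T'\<close> is isometric then \<open>T T'\<close> is the identity, so \<open>T\<close> is onto and every \<open>x\<close> differs from
  \<open>T' T x\<close> by an element of the kernel.
\<close>

lemma coisometry:
  assumes iso: "\<And>y. y \<in> hcarrier K \<Longrightarrow> hnorm H (T' y) = hnorm K y"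
  shows "partial_isometry H K T" and "T ` hcarrier H = hcarrier K"
proof -
  have right_inverse: "T (T' y) = y" if y: "y \<in> hcarrier K" for y
  proof -
    have Ty: "T' y \<in> hcarrier H" "T (T' y) \<in> hcarrier K" using y closed by auto
    have "(hnorm K (T (T' y) - y))\<^sup>2 = (hnorm K (T (T' y)))\<^sup>2 + (hnorm K y)\<^sup>2 - 2 * Re (hinner K (T (T' y)) y)"
      using Ty y by (simp add: cod.hnorm_diff_sq)
    also have "hinner K (T (T' y)) y = of_real ((hnorm K y)\<^sup>2)"
      using Ty y by (simp add: inner dom.inner_self iso)
    also have "(hnorm K (T (T' y)))\<^sup>2 \<le> (hnorm K y)\<^sup>2"
      using contractive[of "T' y"] Ty y iso by (intro power_mono) auto
    finally have "(hnorm K (T (T' y) - y))\<^sup>2 \<le> 0" by simp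
    then have "hnorm K (T (T' y) - y) = 0" by simp
    then show ?thesis using Ty y by simp
  qed
  show "T ` hcarrier H = hcarrier K"
    using right_inverse closed by (auto intro!: image_eqI[of _ T "T' _"])
  have "hnorm K (T x) = hnorm H x"
    if x: "x \<in> hcarrier H" and perp: "\<forall>y\<in>hcarrier H. T y = 0 \<longrightarrow> hinner H x y = 0" for x
  proof -
    have Tx: "T x \<in> hcarrier K" "T' (T x) \<in> hcarrier H" using x closed by auto
    have "hinner H x (x - T' (T x)) = 0"
      using perp x Tx right_inverse by (simp add: diff)
    then have "hinner H x x = hinner K (T x) (T x)"
      using x Tx by (simp add: dom.inner_diff_right inner)
    then show ?thesis by (simp add: hnorm_def)
  qed
  then show "partial_isometry H K T"
    unfolding partial_isometry_def using bounded iso by auto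
qed

end


section \<open>The Hardy space model of a pure contraction\<close>

text \<open>
  Here \<open>T'\<close> and \<open>D\<close> are the adjoints of \<open>T\<close> and \<open>G\<close>; the assumption \<open>defect\<close> is the identity
  \<open>I - T T\<^sup>* = G G\<^sup>*\<close> in the form of norms.
\<close>

locale pure_contraction =
  K: complex_hilbert_space K + U: complex_hilbert_space U
  for K :: "'v::complex_vector hilbert" and U :: "'u::complex_vector hilbert" +
  fixes T T' :: "'v \<Rightarrow> 'v" and G :: "'u \<Rightarrow> 'v" and D :: "'v \<Rightarrow> 'u"
  assumes T: "adjoint_pair K K T T'" and G: "adjoint_pair U K G D"
    and defect: "f \<in> hcarrier K \<Longrightarrow> (hnorm K f)\<^sup>2 = (hnorm K (T' f))\<^sup>2 + (hnorm U (D f))\<^sup>2"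
    and pure: "f \<in> hcarrier K \<Longrightarrow> (\<lambda>k. hnorm K ((T' ^^ k) f)) \<longlonglongrightarrow> 0"
begin

abbreviation l2U :: "(nat \<Rightarrow> 'u) hilbert" where "l2U \<equiv> weighted_l2 (\<lambda>_. 1) U"

definition observe :: "'v \<Rightarrow> nat \<Rightarrow> 'u" where
  "observe f k = D ((T' ^^ k) f)"

sublocale L: complex_hilbert_space l2U
  by (rule complex_hilbert_space_weighted_l2[OF U.complex_hilbert_space_axioms]) simp

lemma power_closed:
  assumes "f \<in> hcarrier K" shows "(T ^^ k) f \<in> hcarrier K" "(T' ^^ k) f \<in> hcarrier K"
  using adjoint_pair_closed[OF adjoint_pair_funpow[OF T]] assms by auto

lemma observe_closed: "f \<in> hcarrier K \<Longrightarrow> observe f k \<in> hcarrier U"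
  using adjoint_pair_closed[OF G] power_closed by (simp add: observe_def)

text \<open>
  The defect identity makes the sum telescope to \<open>\<parallel>f\<parallel>\<^sup>2 - \<parallel>T'\<^sup>N f\<parallel>\<^sup>2\<close>.
\<close>

lemma observe_sums:
  assumes f: "f \<in> hcarrier K"
  shows "(\<lambda>k. (hnorm U (observe f k))\<^sup>2) sums (hnorm K f)\<^sup>2"
proof -
  have "(\<Sum>k<N. (hnorm U (observe f k))\<^sup>2) = (hnorm K f)\<^sup>2 - (hnorm K ((T' ^^ N) f))\<^sup>2" for N
    by (induction N) (use defect[OF power_closed(2)[OF f]] in \<open>simp_all add: observe_def\<close>)
  moreover have "(\<lambda>N. (hnorm K f)\<^sup>2 - (hnorm K ((T' ^^ N) f))\<^sup>2) \<longlonglongrightarrow> (hnorm K f)\<^sup>2 - 0\<^sup>2"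
    by (intro tendsto_intros pure f)
  ultimately show ?thesis by (simp add: sums_def)
qed

lemma observe_l2: "f \<in> hcarrier K \<Longrightarrow> observe f \<in> hcarrier l2U"
  using observe_sums[of f] observe_closed[of f] by (auto simp: weighted_l2_carrier sums_iff)

lemma observe_isometric:
  assumes f: "f \<in> hcarrier K" shows "hnorm l2U (observe f) = hnorm K f"
proof -
  have "(hnorm l2U (observe f))\<^sup>2 = (hnorm K f)\<^sup>2"
    using U.weighted_l2_hnorm[of "\<lambda>_. 1", OF _ observe_l2[OF f]] observe_sums[OF f] by (simp add: sums_iff)
  then show ?thesis using observe_l2[OF f] f by (simp add: power2_eq_iff_nonneg)
qed

definition control_sum :: "nat \<Rightarrow> (nat \<Rightarrow> 'u) \<Rightarrow> 'v" where
  "control_sum N h = (\<Sum>k<N. (T ^^ k) (G (h k)))"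

lemma control_sum_closed:
  "h \<in> hcarrier l2U \<Longrightarrow> control_sum N h \<in> hcarrier K"
  unfolding control_sum_def
  by (intro K.sum_closed power_closed adjoint_pair_closed(1)[OF G]) (simp add: weighted_l2_carrier)

lemma control_sum_inner:
  assumes h: "h \<in> hcarrier l2U" and f: "f \<in> hcarrier K"
  shows "hinner K (control_sum N h) f = (\<Sum>k<N. hinner U (h k) (observe f k))"
proof -
  have hk: "h k \<in> hcarrier U" for k using h by (simp add: weighted_l2_carrier)
  have "hinner K ((T ^^ k) (G (h k))) f = hinner U (h k) (observe f k)" for k
    using adjoint_pair_inner[OF adjoint_pair_compose[OF G adjoint_pair_funpow[OF T, of k]] hk[of k] f]
    by (simp add: observe_def)
  then show ?thesis unfolding control_sum_def
    using hk f power_closed adjoint_pair_closed(1)[OF G] by (subst K.inner_sum_left) auto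
qed

text \<open>
  Let \<open>s\<close> be the block on the left. Then \<open>\<parallel>s\<parallel>\<^sup>2\<close> is the pairing of the same block of \<open>h\<close> with
  \<open>observe s\<close>, whose norm is that of \<open>s\<close>.
\<close>

lemma control_sum_block:
  assumes h: "h \<in> hcarrier l2U" and mn: "m \<le> n"
  shows "(hnorm K (control_sum n h - control_sum m h))\<^sup>2 \<le> (\<Sum>k=m..<n. (hnorm U (h k))\<^sup>2)"
proof -
  define s where "s = control_sum n h - control_sum m h"
  have s: "s \<in> hcarrier K" using h control_sum_closed by (simp add: s_def)
  have hk: "h k \<in> hcarrier U" for k using h by (simp add: weighted_l2_carrier)
  have split: "(\<Sum>k<n. g k) = (\<Sum>k<m. g k) + (\<Sum>k=m..<n. g k)" for g :: "nat \<Rightarrow> complex"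
    using mn sum.atLeastLessThan_concat[of 0 m n g] by (simp add: atLeast0LessThan)
  have "hinner K s s = hinner K (control_sum n h) s - hinner K (control_sum m h) s"
    using s control_sum_closed[OF h] by (subst s_def) (simp add: K.inner_diff_left)
  also have "\<dots> = (\<Sum>k=m..<n. hinner U (h k) (observe s k))"
    using h s by (simp add: control_sum_inner split)
  finally have "(hnorm K s)\<^sup>2 = (\<Sum>k=m..<n. Re (hinner U (h k) (observe s k)))"
    using s by (simp add: K.hnorm_sq)
  also have "\<dots> \<le> (\<Sum>k=m..<n. ((hnorm U (h k))\<^sup>2 + (hnorm U (observe s k))\<^sup>2) / 2)"
  proof (rule sum_mono)
    fix k
    have "Re (hinner U (h k) (observe s k)) \<le> hnorm U (h k) * hnorm U (observe s k)"
      using U.cauchy_schwarz[OF hk observe_closed[OF s]] complex_Re_le_cmod order_trans by blast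
    then show "Re (hinner U (h k) (observe s k)) \<le> ((hnorm U (h k))\<^sup>2 + (hnorm U (observe s k))\<^sup>2) / 2"
      using sum_squares_bound[of "hnorm U (h k)" "hnorm U (observe s k)"] by simp
  qed
  also have "\<dots> = ((\<Sum>k=m..<n. (hnorm U (h k))\<^sup>2) + (\<Sum>k=m..<n. (hnorm U (observe s k))\<^sup>2)) / 2"
    by (simp add: sum_divide_distrib[symmetric] sum.distrib)
  finally have "2 * (hnorm K s)\<^sup>2 \<le> (\<Sum>k=m..<n. (hnorm U (h k))\<^sup>2) + (\<Sum>k=m..<n. (hnorm U (observe s k))\<^sup>2)"
    by simp
  moreover have "(\<Sum>k=m..<n. (hnorm U (observe s k))\<^sup>2) \<le> (hnorm K s)\<^sup>2"
    using observe_sums[OF s] sum_le_suminf[of "\<lambda>k. (hnorm U (observe s k))\<^sup>2" "{m..<n}"]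
    by (simp add: sums_iff)
  ultimately show ?thesis unfolding s_def by linarith
qed

lemma control_sum_converges:
  assumes h: "h \<in> hcarrier l2U"
  shows "\<exists>l\<in>hcarrier K. (\<lambda>N. hnorm K (control_sum N h - l)) \<longlonglongrightarrow> 0"
proof -
  have "\<exists>N. \<forall>m\<ge>N. \<forall>n\<ge>N. hnorm K (control_sum m h - control_sum n h) < e" if e: "e > 0" for e
  proof -
    have "summable (\<lambda>k. (hnorm U (h k))\<^sup>2)" using h by (simp add: weighted_l2_carrier)
    then obtain N where N: "\<And>m n. m \<ge> N \<Longrightarrow> norm (\<Sum>k=m..<n. (hnorm U (h k))\<^sup>2) < e\<^sup>2"
      unfolding summable_Cauchy using e by (meson zero_less_power)
    have *: "hnorm K (control_sum n h - control_sum m h) < e" if "m \<ge> N" "m \<le> n" for m n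
    proof (rule power2_less_imp_less)
      show "(hnorm K (control_sum n h - control_sum m h))\<^sup>2 < e\<^sup>2"
        using control_sum_block[OF h that(2)] N[OF that(1), of n] by simp
    qed (use e in simp)
    have "hnorm K (control_sum m h - control_sum n h) < e" if "m \<ge> N" "n \<ge> N" for m n
      using *[of m n] *[of n m] that K.hnorm_minus_commute[OF control_sum_closed[OF h] control_sum_closed[OF h], of m n]
      by (cases "m \<le> n") auto
    then show ?thesis by blast
  qed
  then show ?thesis using K.cauchy_converges[of "\<lambda>N. control_sum N h"] control_sum_closed[OF h] by metis
qed

text \<open>
  The adjoint of \<open>observe\<close>, built as a norm limit of finite sums because these give access to its
  point values.
\<close>

definition control :: "(nat \<Rightarrow> 'u) \<Rightarrow> 'v" where
  "control h = (SOME l. l \<in> hcarrier K \<and> (\<lambda>N. hnorm K (control_sum N h - l)) \<longlonglongrightarrow> 0)"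

lemma control:
  assumes h: "h \<in> hcarrier l2U"
  shows "control h \<in> hcarrier K" "(\<lambda>N. hnorm K (control_sum N h - control h)) \<longlonglongrightarrow> 0"
  using someI_ex[of "\<lambda>l. l \<in> hcarrier K \<and> (\<lambda>N. hnorm K (control_sum N h - l)) \<longlonglongrightarrow> 0"]
    control_sum_converges[OF h] by (auto simp: control_def)

lemma control_observe: "adjoint_pair l2U K control observe"
  unfolding adjoint_pair_def
proof (intro conjI ballI)
  fix h f assume h: "h \<in> hcarrier l2U" and f: "f \<in> hcarrier K"
  have "(\<lambda>N. hinner K (control_sum N h) f) \<longlonglongrightarrow> hinner K (control h) f"
    by (rule K.limit_inner) (use h f control control_sum_closed in auto)
  then have "(\<lambda>k. hinner U (h k) (observe f k)) sums hinner K (control h) f"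
    by (simp add: sums_def control_sum_inner h f)
  then show "hinner K (control h) f = hinner l2U h (observe f)"
    by (simp add: weighted_l2_inner sums_iff)
qed (use control observe_l2 in auto)

end


section \<open>Vector-valued power series\<close>

context complex_inner_space
begin

lemma hsums_iff:
  assumes "\<And>j. a j \<in> hcarrier H"
  shows "hsums H a s \<longleftrightarrow> s \<in> hcarrier H \<and> (\<lambda>N. hnorm H ((\<Sum>j<N. a j) - s)) \<longlonglongrightarrow> 0"
  unfolding hsums_def using assms by (intro limitin_iff) auto

lemma hsums_unique:
  assumes "\<And>j. a j \<in> hcarrier H" "hsums H a s" "hsums H a t"
  shows "s = t"
  by (rule limit_unique[of "\<lambda>N. \<Sum>j<N. a j"]) (use assms in \<open>auto simp: hsums_iff\<close>)

lemma hsums_add: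
  assumes a: "\<And>j. a j \<in> hcarrier H" and b: "\<And>j. b j \<in> hcarrier H"
    and "hsums H a s" "hsums H b t"
  shows "hsums H (\<lambda>j. a j + b j) (s + t)"
proof -
  have st: "s \<in> hcarrier H" "t \<in> hcarrier H"
    and lim: "(\<lambda>N. hnorm H ((\<Sum>j<N. a j) - s)) \<longlonglongrightarrow> 0" "(\<lambda>N. hnorm H ((\<Sum>j<N. b j) - t)) \<longlonglongrightarrow> 0"
    using assms by (auto simp: hsums_iff)
  have "(\<lambda>N. hnorm H ((\<Sum>j<N. a j + b j) - (s + t))) \<longlonglongrightarrow> 0"
  proof (rule Lim_null_comparison)
    show "(\<lambda>N. hnorm H ((\<Sum>j<N. a j) - s) + hnorm H ((\<Sum>j<N. b j) - t)) \<longlonglongrightarrow> 0"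
      using tendsto_add[OF lim] by simp
    have "hnorm H ((\<Sum>j<N. a j + b j) - (s + t)) \<le> hnorm H ((\<Sum>j<N. a j) - s) + hnorm H ((\<Sum>j<N. b j) - t)" for N
      using hnorm_add_le[of "(\<Sum>j<N. a j) - s" "(\<Sum>j<N. b j) - t"] a b st
      by (simp add: sum.distrib add_diff_add)
    then show "\<forall>\<^sub>F N in sequentially. norm (hnorm H ((\<Sum>j<N. a j + b j) - (s + t)))
        \<le> hnorm H ((\<Sum>j<N. a j) - s) + hnorm H ((\<Sum>j<N. b j) - t)"
      using a b st by (intro always_eventually) (simp add: abs_of_nonneg)
  qed
  then show ?thesis using a b st by (subst hsums_iff) auto
qed

lemma hsums_scale:
  assumes a: "\<And>j. a j \<in> hcarrier H" and "hsums H a s"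
  shows "hsums H (\<lambda>j. c *\<^sub>C a j) (c *\<^sub>C s)"
proof -
  have s: "s \<in> hcarrier H" and lim: "(\<lambda>N. hnorm H ((\<Sum>j<N. a j) - s)) \<longlonglongrightarrow> 0"
    using assms by (auto simp: hsums_iff)
  have "hnorm H ((\<Sum>j<N. c *\<^sub>C a j) - c *\<^sub>C s) = cmod c * hnorm H ((\<Sum>j<N. a j) - s)" for N
    using a s
    by (simp add: complex_vector.scale_sum_right[symmetric]
        complex_vector.scale_right_diff_distrib[symmetric] hnorm_scale)
  then have "(\<lambda>N. hnorm H ((\<Sum>j<N. c *\<^sub>C a j) - c *\<^sub>C s)) \<longlonglongrightarrow> 0"
    using tendsto_mult_left[OF lim, of "cmod c"] by simp
  then show ?thesis using a s by (subst hsums_iff) auto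
qed

lemma hsums_diff:
  assumes a: "\<And>j. a j \<in> hcarrier H" and b: "\<And>j. b j \<in> hcarrier H"
    and "hsums H a s" "hsums H b t"
  shows "hsums H (\<lambda>j. a j - b j) (s - t)"
  using hsums_add[OF a _ assms(3) hsums_scale[OF b assms(4), of "-1"]] b
  by (simp add: complex_vector.scale_minus_left scaleC_one)

lemma hsums_inner:
  assumes a: "\<And>j. a j \<in> hcarrier H" and "hsums H a s" and y: "y \<in> hcarrier H"
  shows "(\<lambda>j. hinner H (a j) y) sums hinner H s y"
  using limit_inner[of "\<lambda>N. \<Sum>j<N. a j" s y] assms
  by (simp add: hsums_iff sums_def inner_sum_left)

lemma hsums_bound:
  assumes a: "\<And>j. a j \<in> hcarrier H" and s: "hsums H a s"
    and b: "\<And>j. hnorm H (a j) \<le> b j" and "summable b"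
  shows "hnorm H s \<le> suminf b"
proof (rule LIMSEQ_le_const2)
  show "(\<lambda>N. hnorm H (\<Sum>j<N. a j)) \<longlonglongrightarrow> hnorm H s"
    using limit_hnorm[of "\<lambda>N. \<Sum>j<N. a j" s] a s by (simp add: hsums_iff)
  have "hnorm H (\<Sum>j<N. a j) \<le> suminf b" for N
  proof -
    have "hnorm H (\<Sum>j<N. a j) \<le> (\<Sum>j<N. b j)"
      using hnorm_sum_le[of "{..<N}" a] a b sum_mono[of "{..<N}" "\<lambda>j. hnorm H (a j)" b] by auto
    also have "\<dots> \<le> suminf b"
      using assms(4) order_trans[OF hnorm_nonneg[OF a] b] by (intro sum_le_suminf) auto
    finally show ?thesis .
  qed
  then show "\<exists>N. \<forall>n\<ge>N. hnorm H (\<Sum>j<n. a j) \<le> suminf b" by blast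
qed

end

context complex_hilbert_space
begin

lemma hsums_exists:
  assumes a: "\<And>j. a j \<in> hcarrier H" and b: "\<And>j. hnorm H (a j) \<le> b j" and "summable b"
  shows "\<exists>s. hsums H a s"
proof -
  have "\<exists>N. \<forall>m\<ge>N. \<forall>n\<ge>N. hnorm H ((\<Sum>j<m. a j) - (\<Sum>j<n. a j)) < e" if e: "e > 0" for e
  proof -
    obtain N where N: "\<And>m n. m \<ge> N \<Longrightarrow> norm (\<Sum>j=m..<n. b j) < e"
      using assms(3) e unfolding summable_Cauchy by blast
    have *: "hnorm H ((\<Sum>j<n. a j) - (\<Sum>j<m. a j)) < e" if "m \<ge> N" "m \<le> n" for m n
    proof -
      have "(\<Sum>j<n. a j) - (\<Sum>j<m. a j) = (\<Sum>j=m..<n. a j)"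
        using sum.atLeastLessThan_concat[of 0 m n a] that by (simp add: atLeast0LessThan algebra_simps)
      also have "hnorm H \<dots> \<le> (\<Sum>j=m..<n. b j)"
        using hnorm_sum_le[of "{m..<n}" a] a b sum_mono[of "{m..<n}" "\<lambda>j. hnorm H (a j)" b] by auto
      also have "\<dots> < e" using N[OF that(1), of n] by simp
      finally show ?thesis .
    qed
    have "hnorm H ((\<Sum>j<m. a j) - (\<Sum>j<n. a j)) < e" if "m \<ge> N" "n \<ge> N" for m n
      using *[of m n] *[of n m] that a hnorm_minus_commute[of "\<Sum>j<m. a j" "\<Sum>j<n. a j"]
      by (cases "m \<le> n") auto
    then show ?thesis by blast
  qed
  then show ?thesis using cauchy_converges[of "\<lambda>N. \<Sum>j<N. a j"] a by (metis hsums_iff sum_closed)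
qed

end

text \<open>
  Dividing by the power of \<open>z\<close> that precedes the first coefficient in question reduces the claim
  to the limit of the series at \<open>0\<close>.
\<close>

lemma power_series_zero_coefficients:
  fixes c :: "nat \<Rightarrow> complex"
  assumes "\<And>z. norm z < 1 \<Longrightarrow> (\<lambda>n. c n * z ^ n) sums 0"
  shows "c m = 0"
proof (induction m rule: less_induct)
  case (less m)
  have "(\<lambda>n. c (n + m) * z ^ n) sums 0" if z: "z \<noteq> 0" "norm z < 1" for z
  proof -
    have "(\<lambda>n. c (n + m) * z ^ (n + m)) sums 0"
      using assms[OF z(2)] less sums_iff_shift[of "\<lambda>n. c n * z ^ n" m 0] by simp
    from sums_mult[OF this, of "inverse (z ^ m)"] show ?thesis
      using z by (simp add: power_add field_simps)
  qed
  then have "((\<lambda>_::complex. 0) \<longlongrightarrow> c (0 + m)) (at (0::complex))"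
    using powser_limit_0_strong[of 1 "\<lambda>n. c (n + m)" "\<lambda>_. 0"] by simp
  then show ?case using tendsto_unique[OF _ _ tendsto_const] by (metis add_0 at_neq_bot)
qed

context complex_inner_space
begin

text \<open>
  Pairing with the difference \<open>y\<close> of the two \<open>m\<close>-th coefficients gives a scalar power series that
  vanishes on the disk; its \<open>m\<close>-th coefficient is \<open>\<parallel>y\<parallel>\<^sup>2\<close>.
\<close>

lemma power_series_unique:
  assumes a: "power_series_on_disk H f a" and b: "power_series_on_disk H f b"
  shows "a = b"
proof
  fix m
  have aC: "a j \<in> hcarrier H" and bC: "b j \<in> hcarrier H" for j
    using a b by (auto simp: power_series_on_disk_def)
  define y where "y = a m - b m"
  have y: "y \<in> hcarrier H" using aC bC by (simp add: y_def)
  have "(\<lambda>j. hinner H (a j - b j) y * z ^ j) sums 0" if "norm z < 1" for z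
  proof -
    have "hsums H (\<lambda>j. z ^ j *\<^sub>C a j) (f z)" "hsums H (\<lambda>j. z ^ j *\<^sub>C b j) (f z)"
      using a b that by (auto simp: power_series_on_disk_def)
    then have "(\<lambda>j. hinner H (z ^ j *\<^sub>C a j) y - hinner H (z ^ j *\<^sub>C b j) y) sums (hinner H (f z) y - hinner H (f z) y)"
      by (intro sums_diff hsums_inner y) (use aC bC in auto)
    then show ?thesis using aC bC y by (simp add: inner_scale_left inner_diff_left right_diff_distrib mult.commute)
  qed
  from power_series_zero_coefficients[OF this] have "hinner H (a m - b m) y = 0" .
  then have "y = 0" using y by (intro inner_definite) (auto simp: y_def)
  then show "a m = b m" by (simp add: y_def)
qed

lemma taylor_coeffs_eq: "power_series_on_disk H f a \<Longrightarrow> taylor_coeffs H f = a"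
  unfolding taylor_coeffs_def using power_series_unique by (intro the_equality) auto

lemma power_series_values_unique:
  assumes "power_series_on_disk H f a" "power_series_on_disk H g a"
  shows "f = g"
proof
  fix z
  show "f z = g z"
  proof (cases "z \<in> unit_disk")
    case True
    then show ?thesis using assms
      by (intro hsums_unique[of "\<lambda>j. z ^ j *\<^sub>C a j"]) (auto simp: power_series_on_disk_def)
  qed (use assms in \<open>auto simp: power_series_on_disk_def\<close>)
qed

lemma power_series_add:
  assumes "power_series_on_disk H f a" "power_series_on_disk H g b"
  shows "power_series_on_disk H (f + g) (a + b)"
  using assms unfolding power_series_on_disk_def
  by (auto simp: scaleC_add_right intro!: hsums_add)

lemma power_series_scale:
  assumes "power_series_on_disk H f a"
  shows "power_series_on_disk H (c *\<^sub>C f) (c *\<^sub>C a)"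
proof -
  have "hsums H (\<lambda>j. z ^ j *\<^sub>C c *\<^sub>C a j) (c *\<^sub>C f z)" if "z \<in> unit_disk" for z
    using hsums_scale[of "\<lambda>j. z ^ j *\<^sub>C a j" "f z" c] assms that
    by (simp add: power_series_on_disk_def scaleC_scaleC mult.commute)
  then show ?thesis using assms by (auto simp: power_series_on_disk_def scaleC_fun_def)
qed

lemma power_series_shift:
  assumes f: "power_series_on_disk H f a"
  shows "power_series_on_disk H (bergman_shift f) (\<lambda>j. case j of 0 \<Rightarrow> 0 | Suc i \<Rightarrow> a i)"
proof -
  have aC: "a j \<in> hcarrier H" for j using f by (simp add: power_series_on_disk_def)
  have bC: "(case j of 0 \<Rightarrow> 0 | Suc i \<Rightarrow> a i) \<in> hcarrier H" for j using aC by (simp split: nat.split)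
  have "hsums H (\<lambda>j. z ^ j *\<^sub>C (case j of 0 \<Rightarrow> 0 | Suc i \<Rightarrow> a i)) (z *\<^sub>C f z)" if "z \<in> unit_disk" for z
  proof -
    have "hsums H (\<lambda>j. z ^ j *\<^sub>C a j) (f z)" using f that by (simp add: power_series_on_disk_def)
    from hsums_scale[OF _ this, of z] have "hsums H (\<lambda>j. z ^ Suc j *\<^sub>C a j) (z *\<^sub>C f z)"
      using aC by (simp add: scaleC_scaleC)
    then have fz: "z *\<^sub>C f z \<in> hcarrier H"
      and lim: "(\<lambda>N. hnorm H ((\<Sum>j<N. z ^ Suc j *\<^sub>C a j) - z *\<^sub>C f z)) \<longlonglongrightarrow> 0"
      using aC by (auto simp: hsums_iff)
    have "(\<lambda>N. hnorm H ((\<Sum>j<Suc N. z ^ j *\<^sub>C (case j of 0 \<Rightarrow> 0 | Suc i \<Rightarrow> a i)) - z *\<^sub>C f z)) \<longlonglongrightarrow> 0"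
      using lim unfolding sum.lessThan_Suc_shift by simp
    then have "(\<lambda>N. hnorm H ((\<Sum>j<N. z ^ j *\<^sub>C (case j of 0 \<Rightarrow> 0 | Suc i \<Rightarrow> a i)) - z *\<^sub>C f z)) \<longlonglongrightarrow> 0"
      by (rule LIMSEQ_imp_Suc)
    then show ?thesis using bC fz by (subst hsums_iff) auto
  qed
  then show ?thesis using f bC by (auto simp: power_series_on_disk_def bergman_shift_def)
qed

end


section \<open>The weighted Bergman spaces\<close>

lemma bergman_weight_0 [simp]: "bergman_weight n 0 = 1"
  by (simp add: bergman_weight_def)

lemma bergman_weight_one [simp]: "bergman_weight (Suc 0) j = 1"
  by (simp add: bergman_weight_def)

lemma bergman_weight_pos: "n \<ge> 1 \<Longrightarrow> bergman_weight n j > 0"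
  by (simp add: bergman_weight_def)

lemma bergman_weight_Suc:
  assumes "n \<ge> 1"
  shows "bergman_weight n (Suc j) = bergman_weight n j * (real (j + 1) / real (n + j))"
proof -
  obtain m where m: "n = Suc m" using assms by (cases n) auto
  have "Suc j * (Suc (m + j) choose Suc j) = Suc (m + j) * (m + j choose j)"
    by (rule Suc_times_binomial)
  then have "real (Suc j) * real (Suc (m + j) choose Suc j) = real (Suc (m + j)) * real (m + j choose j)"
    by (metis of_nat_mult)
  moreover have "real (m + j choose j) > 0" "real (Suc (m + j) choose Suc j) > 0"
    using zero_less_binomial[of "Suc j" "Suc (m + j)"] by (simp_all del: binomial_Suc_Suc)
  moreover have "1 / b = 1 / a * (real (j + 1) / real (Suc m + j))"
    if "real (Suc j) * b = real (Suc (m + j)) * a" "a > 0" "b > 0" for a b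
    using that by (simp add: divide_simps)
  ultimately show ?thesis unfolding bergman_weight_def m by (simp del: binomial_Suc_Suc)
qed

lemma bergman_weight_Suc_le: "n \<ge> 1 \<Longrightarrow> bergman_weight n (Suc j) \<le> bergman_weight n j"
  unfolding bergman_weight_Suc using bergman_weight_pos[of n j]
  by (intro mult_left_le) auto

lemma bergman_weight_le_1: "n \<ge> 1 \<Longrightarrow> bergman_weight n j \<le> 1"
proof (induction j)
  case (Suc j)
  then show ?case using bergman_weight_Suc_le[of n j] by simp
qed simp

text \<open>
  Ratio test: the quotient \<open>\<mu>\<^sub>n\<^sub>,\<^sub>j / \<mu>\<^sub>n\<^sub>,\<^sub>j\<^sub>+\<^sub>1 = (n + j) / (j + 1)\<close> tends to \<open>1\<close>, so its product
  with \<open>\<bar>r\<bar>\<close> is eventually at most the midpoint \<open>c\<close> of \<open>\<bar>r\<bar>\<close> and \<open>1\<close>.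
\<close>

lemma bergman_weight_summable:
  assumes n: "n \<ge> 1" and r: "norm (r::real) < 1"
  shows "summable (\<lambda>j. 1 / bergman_weight n j * r ^ j)"
proof -
  define c where "c = (1 + \<bar>r\<bar>) / 2"
  have c: "\<bar>r\<bar> < c" "c < 1" "c > 0" using r by (auto simp: c_def)
  obtain N where N: "real n * \<bar>r\<bar> / (c - \<bar>r\<bar>) < real N" using reals_Archimedean2 by blast
  show ?thesis
  proof (rule summable_ratio_test[OF c(2)])
    fix j assume j: "j \<ge> N"
    have "real n * \<bar>r\<bar> < (c - \<bar>r\<bar>) * real N" using N c by (simp add: field_simps)
    also have "\<dots> \<le> (c - \<bar>r\<bar>) * real j" using c j by (intro mult_left_mono) auto
    finally have "real (n + j) * \<bar>r\<bar> \<le> c * real (j + 1)" using c by (simp add: algebra_simps)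
    then have le: "real (n + j) / real (j + 1) * \<bar>r\<bar> \<le> c" by (simp add: field_simps)
    have w: "bergman_weight n j > 0" by (rule bergman_weight_pos[OF n])
    have "norm (1 / bergman_weight n (Suc j) * r ^ Suc j)
        = (real (n + j) / real (j + 1) * \<bar>r\<bar>) * (1 / bergman_weight n j * \<bar>r\<bar> ^ j)"
      using w n by (simp add: bergman_weight_Suc abs_mult power_abs mult_ac)
    also have "\<dots> \<le> c * (1 / bergman_weight n j * \<bar>r\<bar> ^ j)"
      using w by (intro mult_right_mono le) auto
    finally show "norm (1 / bergman_weight n (Suc j) * r ^ Suc j) \<le> c * norm (1 / bergman_weight n j * r ^ j)"
      using w by (simp add: abs_mult power_abs)
  qed
qed

locale bergman = Y: complex_hilbert_space Y for Y :: "'y::complex_vector hilbert" +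
  fixes n :: nat
  assumes n: "n \<ge> 1"
begin

abbreviation "A \<equiv> bergman_space n Y"
abbreviation "l2 \<equiv> weighted_l2 (bergman_weight n) Y"
abbreviation "tc \<equiv> taylor_coeffs Y"

lemma weight_pos: "bergman_weight n j > 0" and weight_nonneg: "bergman_weight n j \<ge> 0"
  using bergman_weight_pos[OF n] less_imp_le by auto

lemma carrier_iff: "f \<in> hcarrier A \<longleftrightarrow> (\<exists>a\<in>hcarrier l2. power_series_on_disk Y f a)"
proof -
  have "bergman_weight n j \<noteq> 0" for j using weight_pos[of j] by simp
  then show ?thesis
    by (simp add: bergman_space_def weighted_l2_carrier power_series_on_disk_def Bex_def) blast
qed

lemma carrierI: "power_series_on_disk Y f a \<Longrightarrow> a \<in> hcarrier l2 \<Longrightarrow> f \<in> hcarrier A"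
  using carrier_iff by blast

lemma taylor:
  assumes "f \<in> hcarrier A"
  shows "tc f \<in> hcarrier l2" "power_series_on_disk Y f (tc f)"
  using assms Y.taylor_coeffs_eq unfolding carrier_iff by auto

lemma taylor_in: "f \<in> hcarrier A \<Longrightarrow> tc f j \<in> hcarrier Y"
  using taylor(1) by (simp add: weighted_l2_carrier)

lemma inner_eq: "hinner A f g = hinner l2 (tc f) (tc g)"
  by (simp add: bergman_space_def weighted_l2_inner)

lemma hnorm_eq: "hnorm A f = hnorm l2 (tc f)"
  by (simp add: hnorm_def inner_eq)

text \<open>
  The sharp factor is \<open>\<mu>\<^sub>n\<^sub>,\<^sub>j\<^sup>-\<^sup>1\<^sup>/\<^sup>2\<close>; as \<open>\<mu>\<^sub>n\<^sub>,\<^sub>j \<le> 1\<close>, the rational factor below is weaker, and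
  \<open>bergman_weight_summable\<close> applies to it.
\<close>

lemma coordinate_bound:
  assumes a: "a \<in> hcarrier l2"
  shows "hnorm Y (a j) \<le> 1 / bergman_weight n j * hnorm l2 a"
proof -
  interpret l2: complex_inner_space l2 by (rule Y.complex_inner_space_weighted_l2[OF weight_nonneg])
  let ?w = "bergman_weight n j"
  have "?w * (?w * (hnorm Y (a j))\<^sup>2) \<le> 1 * (?w * (hnorm Y (a j))\<^sup>2)"
    using bergman_weight_le_1[OF n] weight_nonneg by (intro mult_right_mono) auto
  also have "\<dots> \<le> (hnorm l2 a)\<^sup>2"
    using Y.weighted_l2_coordinate_le[OF weight_nonneg a] by simp
  finally have le: "(?w * hnorm Y (a j))\<^sup>2 \<le> (hnorm l2 a)\<^sup>2"
    by (simp add: power2_eq_square ac_simps)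
  have "?w * hnorm Y (a j) \<le> hnorm l2 a"
    using power2_le_imp_le[OF le] a by simp
  then show ?thesis using weight_pos[of j] by (simp add: field_simps)
qed

lemma power_series_exists:
  assumes a: "a \<in> hcarrier l2"
  shows "\<exists>f\<in>hcarrier A. power_series_on_disk Y f a"
proof -
  have aC: "a j \<in> hcarrier Y" for j using a by (simp add: weighted_l2_carrier)
  have "\<exists>s. hsums Y (\<lambda>j. z ^ j *\<^sub>C a j) s" if z: "cmod z < 1" for z
  proof (rule Y.hsums_exists)
    show "hnorm Y (z ^ j *\<^sub>C a j) \<le> 1 / bergman_weight n j * cmod z ^ j * hnorm l2 a" for j
      using mult_left_mono[OF coordinate_bound[OF a, of j], of "cmod z ^ j"] aC
      by (simp add: Y.hnorm_scale norm_power ac_simps)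
    show "summable (\<lambda>j. 1 / bergman_weight n j * cmod z ^ j * hnorm l2 a)"
      using bergman_weight_summable[OF n, of "cmod z"] z by (intro summable_mult2) auto
  qed (use aC in auto)
  then have "\<exists>g. \<forall>z. cmod z < 1 \<longrightarrow> hsums Y (\<lambda>j. z ^ j *\<^sub>C a j) (g z)"
    by (intro choice) blast
  then obtain g where g: "\<And>z. cmod z < 1 \<Longrightarrow> hsums Y (\<lambda>j. z ^ j *\<^sub>C a j) (g z)" by blast
  have "power_series_on_disk Y (\<lambda>z. if cmod z < 1 then g z else 0) a"
    using g aC by (auto simp: power_series_on_disk_def)
  then show ?thesis using carrierI[OF _ a] by blast
qed

text \<open>
  The inverse of the Taylor coefficient map.
\<close>

definition of_coeffs :: "(nat \<Rightarrow> 'y) \<Rightarrow> complex \<Rightarrow> 'y" where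
  "of_coeffs a = (SOME f. f \<in> hcarrier A \<and> power_series_on_disk Y f a)"

lemma of_coeffs:
  assumes "a \<in> hcarrier l2"
  shows "of_coeffs a \<in> hcarrier A" "power_series_on_disk Y (of_coeffs a) a" "tc (of_coeffs a) = a"
proof -
  have "\<exists>f. f \<in> hcarrier A \<and> power_series_on_disk Y f a"
    using power_series_exists[OF assms] by blast
  then have "of_coeffs a \<in> hcarrier A \<and> power_series_on_disk Y (of_coeffs a) a"
    unfolding of_coeffs_def by (rule someI_ex)
  then show "of_coeffs a \<in> hcarrier A" "power_series_on_disk Y (of_coeffs a) a" "tc (of_coeffs a) = a"
    using Y.taylor_coeffs_eq by auto
qed

lemma hilbert: "complex_hilbert_space A"
proof (rule complex_hilbert_space_isomorphic[where f = of_coeffs and H = l2])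
  show l2: "complex_hilbert_space l2"
    by (rule complex_hilbert_space_weighted_l2[OF Y.complex_hilbert_space_axioms weight_nonneg])
  interpret l2: complex_hilbert_space l2 by fact
  have "f = of_coeffs (tc f)" if "f \<in> hcarrier A" for f
    using Y.power_series_values_unique[OF taylor(2)[OF that] of_coeffs(2)[OF taylor(1)[OF that]]] .
  then show "of_coeffs ` hcarrier l2 = hcarrier A"
    using of_coeffs(1) taylor(1) by blast
  show "of_coeffs (a + b) = of_coeffs a + of_coeffs b"
    if "a \<in> hcarrier l2" "b \<in> hcarrier l2" for a b
    using Y.power_series_values_unique[OF of_coeffs(2)[OF l2.add_closed[OF that]]
        Y.power_series_add[OF of_coeffs(2)[OF that(1)] of_coeffs(2)[OF that(2)]]] .
  show "of_coeffs (c *\<^sub>C a) = c *\<^sub>C of_coeffs a" if "a \<in> hcarrier l2" for a c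
    using Y.power_series_values_unique[OF of_coeffs(2)[OF l2.scale_closed[OF that]]
        Y.power_series_scale[OF of_coeffs(2)[OF that]]] .
  show "hinner A (of_coeffs a) (of_coeffs b) = hinner l2 a b"
    if "a \<in> hcarrier l2" "b \<in> hcarrier l2" for a b
    using that by (simp add: inner_eq of_coeffs)
qed

sublocale A: complex_hilbert_space A by (rule hilbert)
sublocale l2: complex_hilbert_space l2
  by (rule complex_hilbert_space_weighted_l2[OF Y.complex_hilbert_space_axioms weight_nonneg])

lemma tc_add: "f \<in> hcarrier A \<Longrightarrow> g \<in> hcarrier A \<Longrightarrow> tc (f + g) = tc f + tc g"
  by (intro Y.taylor_coeffs_eq Y.power_series_add taylor(2))

lemma tc_scale: "f \<in> hcarrier A \<Longrightarrow> tc (c *\<^sub>C f) = c *\<^sub>C tc f"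
  by (intro Y.taylor_coeffs_eq Y.power_series_scale taylor(2))

lemma hnorm_sums:
  assumes "f \<in> hcarrier A"
  shows "(\<lambda>j. bergman_weight n j * (hnorm Y (tc f j))\<^sup>2) sums (hnorm A f)\<^sup>2"
  using Y.weighted_l2_hnorm[OF weight_nonneg taylor(1)[OF assms]] taylor(1)[OF assms]
  by (simp add: hnorm_eq weighted_l2_carrier sums_iff)

lemma expansion:
  "f \<in> hcarrier A \<Longrightarrow> cmod z < 1 \<Longrightarrow> hsums Y (\<lambda>j. z ^ j *\<^sub>C tc f j) (f z)"
  using taylor(2) by (auto simp: power_series_on_disk_def)

lemma value_in: "f \<in> hcarrier A \<Longrightarrow> f z \<in> hcarrier Y"
  using expansion[of f z] taylor(2)[of f] taylor_in[of f]
  by (cases "cmod z < 1") (auto simp: Y.hsums_iff power_series_on_disk_def)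

lemma value_outside: "f \<in> hcarrier A \<Longrightarrow> \<not> cmod z < 1 \<Longrightarrow> f z = 0"
  using taylor(2)[of f] by (auto simp: power_series_on_disk_def)

text \<open>
  A series whose scalar factors are dominated by \<open>b j\<close> is controlled by \<open>\<Sum> b j / \<mu>\<^sub>n\<^sub>,\<^sub>j\<close>. This
  gives the bounds on point evaluation, on its derivative, and on difference quotients.
\<close>

lemma scaled_coefficient_le:
  assumes f: "f \<in> hcarrier A" and t: "cmod t \<le> b"
  shows "hnorm Y (t *\<^sub>C tc f j) \<le> (1 / bergman_weight n j * b) * hnorm A f"
proof -
  have "hnorm Y (t *\<^sub>C tc f j) = cmod t * hnorm Y (tc f j)"
    using taylor_in[OF f] by (simp add: Y.hnorm_scale)
  also have "\<dots> \<le> b * (1 / bergman_weight n j * hnorm A f)"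
    using coordinate_bound[OF taylor(1)[OF f]] t taylor_in[OF f] order_trans[OF norm_ge_zero t]
    by (intro mult_mono) (auto simp: hnorm_eq)
  finally show ?thesis by (simp add: ac_simps)
qed

lemma multiplier_exists:
  assumes f: "f \<in> hcarrier A"
    and t: "\<And>j. cmod (t j) \<le> b j" and b: "summable (\<lambda>j. 1 / bergman_weight n j * b j)"
  shows "\<exists>s. hsums Y (\<lambda>j. t j *\<^sub>C tc f j) s"
proof (rule Y.hsums_exists)
  show "hnorm Y (t j *\<^sub>C tc f j) \<le> (1 / bergman_weight n j * b j) * hnorm A f" for j
    by (rule scaled_coefficient_le[OF f t])
qed (use taylor_in[OF f] summable_mult2[OF b] in auto)

lemma multiplier_bound:
  assumes f: "f \<in> hcarrier A" and s: "hsums Y (\<lambda>j. t j *\<^sub>C tc f j) s"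
    and t: "\<And>j. cmod (t j) \<le> b j" and b: "summable (\<lambda>j. 1 / bergman_weight n j * b j)"
  shows "hnorm Y s \<le> (\<Sum>j. 1 / bergman_weight n j * b j) * hnorm A f"
proof -
  have "hnorm Y (t j *\<^sub>C tc f j) \<le> (1 / bergman_weight n j * b j) * hnorm A f" for j
    by (rule scaled_coefficient_le[OF f t])
  from Y.hsums_bound[OF _ s this summable_mult2[OF b]]
  show ?thesis using taylor_in[OF f] suminf_mult2[OF b, of "hnorm A f"] by simp
qed

lemma evaluation_bound:
  assumes z: "cmod z < 1"
  shows "\<exists>C. \<forall>f\<in>hcarrier A. hnorm Y (f z) \<le> C * hnorm A f"
  using multiplier_bound[OF _ expansion[OF _ z], of _ "\<lambda>j. cmod z ^ j"]
    bergman_weight_summable[OF n, of "cmod z"] z by (auto simp: norm_power)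

end


section \<open>The shift, its adjoint and its defect\<close>

context bergman
begin

lemma shift_taylor:
  assumes f: "f \<in> hcarrier A"
  shows "bergman_shift f \<in> hcarrier A"
    and "tc (bergman_shift f) = (\<lambda>j. case j of 0 \<Rightarrow> 0 | Suc i \<Rightarrow> tc f i)"
proof -
  let ?b = "\<lambda>j. case j of 0 \<Rightarrow> 0 | Suc i \<Rightarrow> tc f i"
  note ps = Y.power_series_shift[OF taylor(2)[OF f]]
  show "tc (bergman_shift f) = ?b" by (rule Y.taylor_coeffs_eq[OF ps])
  have "summable (\<lambda>j. bergman_weight n (Suc j) * (hnorm Y (tc f j))\<^sup>2)"
  proof (rule summable_comparison_test')
    show "summable (\<lambda>j. bergman_weight n j * (hnorm Y (tc f j))\<^sup>2)"
      using taylor(1)[OF f] by (simp add: weighted_l2_carrier)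
    show "norm (bergman_weight n (Suc j) * (hnorm Y (tc f j))\<^sup>2) \<le> bergman_weight n j * (hnorm Y (tc f j))\<^sup>2" for j
      using weight_nonneg[of "Suc j"] by (simp add: mult_right_mono bergman_weight_Suc_le[OF n])
  qed
  then have "summable (\<lambda>j. bergman_weight n j * (hnorm Y (?b j))\<^sup>2)"
    by (subst summable_Suc_iff[symmetric]) simp
  moreover have "bergman_weight n j \<noteq> 0" for j using weight_pos[of j] by simp
  moreover have "?b j \<in> hcarrier Y" for j using taylor_in[OF f] by (simp split: nat.split)
  ultimately show "bergman_shift f \<in> hcarrier A"
    by (intro carrierI[OF ps]) (simp add: weighted_l2_carrier)
qed

definition ratio :: "nat \<Rightarrow> real" where
  "ratio j = bergman_weight n (Suc j) / bergman_weight n j"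

lemma ratio: "0 \<le> ratio j" "ratio j \<le> 1" "bergman_weight n j * ratio j = bergman_weight n (Suc j)"
  using weight_pos[of j] weight_nonneg[of "Suc j"] bergman_weight_Suc_le[OF n, of j]
  by (auto simp: ratio_def)

definition shift_adjoint :: "(complex \<Rightarrow> 'y) \<Rightarrow> complex \<Rightarrow> 'y" where
  "shift_adjoint f = of_coeffs (\<lambda>j. of_real (ratio j) *\<^sub>C tc f (Suc j))"

lemma shift_adjoint_taylor:
  assumes f: "f \<in> hcarrier A"
  shows "shift_adjoint f \<in> hcarrier A"
    and "tc (shift_adjoint f) = (\<lambda>j. of_real (ratio j) *\<^sub>C tc f (Suc j))"
proof -
  have "summable (\<lambda>j. bergman_weight n j * (hnorm Y (of_real (ratio j) *\<^sub>C tc f (Suc j)))\<^sup>2)"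
  proof (rule summable_comparison_test')
    show "summable (\<lambda>j. bergman_weight n (Suc j) * (hnorm Y (tc f (Suc j)))\<^sup>2)"
      using taylor(1)[OF f] summable_Suc_iff[of "\<lambda>j. bergman_weight n j * (hnorm Y (tc f j))\<^sup>2"]
      by (simp add: weighted_l2_carrier)
    fix j
    have "bergman_weight n j * (hnorm Y (of_real (ratio j) *\<^sub>C tc f (Suc j)))\<^sup>2
        = ratio j * (bergman_weight n (Suc j) * (hnorm Y (tc f (Suc j)))\<^sup>2)"
      using taylor_in[OF f] ratio(1)[of j]
      by (simp add: Y.hnorm_scale ratio(3)[symmetric] power_mult_distrib power2_eq_square)
    also have "\<dots> \<le> 1 * (bergman_weight n (Suc j) * (hnorm Y (tc f (Suc j)))\<^sup>2)"
      using ratio weight_nonneg by (intro mult_right_mono) auto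
    finally show "norm (bergman_weight n j * (hnorm Y (of_real (ratio j) *\<^sub>C tc f (Suc j)))\<^sup>2)
        \<le> bergman_weight n (Suc j) * (hnorm Y (tc f (Suc j)))\<^sup>2"
      using weight_nonneg by simp
  qed
  moreover have "bergman_weight n j \<noteq> 0" for j using weight_pos[of j] by simp
  ultimately have "(\<lambda>j. of_real (ratio j) *\<^sub>C tc f (Suc j)) \<in> hcarrier l2"
    using taylor_in[OF f] by (simp add: weighted_l2_carrier)
  from of_coeffs[OF this] show "shift_adjoint f \<in> hcarrier A"
    "tc (shift_adjoint f) = (\<lambda>j. of_real (ratio j) *\<^sub>C tc f (Suc j))"
    by (auto simp: shift_adjoint_def)
qed

lemma shift_adjoint_pair: "adjoint_pair A A bergman_shift shift_adjoint"
  unfolding adjoint_pair_def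
proof (intro conjI ballI)
  fix f g assume f: "f \<in> hcarrier A" and g: "g \<in> hcarrier A"
  let ?h = "\<lambda>j. of_real (bergman_weight n j) * hinner Y (tc (bergman_shift f) j) (tc g j)"
  have h0: "?h 0 = 0" using taylor_in[OF g] by (simp add: shift_taylor[OF f])
  have hS: "?h (Suc j) = of_real (bergman_weight n j) * hinner Y (tc f j) (tc (shift_adjoint g) j)" for j
    using taylor_in[OF f] taylor_in[OF g]
    by (simp add: shift_taylor[OF f] shift_adjoint_taylor[OF g] Y.inner_scale_right ratio(3)[symmetric])
  have "summable ?h"
    using Y.weighted_l2_summable[OF weight_nonneg taylor(1)[OF shift_taylor(1)[OF f]] taylor(1)[OF g]] .
  then have "hinner A (bergman_shift f) g = (\<Sum>j. ?h (Suc j))"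
    unfolding inner_eq weighted_l2_inner using suminf_split_head[of ?h] h0 by simp
  then show "hinner A (bergman_shift f) g = hinner A f (shift_adjoint g)"
    unfolding hS by (simp add: inner_eq weighted_l2_inner)
qed (use shift_taylor shift_adjoint_taylor in auto)

text \<open>
  The entries of the diagonal operator \<open>E = (I - S S\<^sup>*)\<^sup>1\<^sup>/\<^sup>2\<close>; the constants are orthogonal to the
  range of \<open>S\<close>, which gives the entry \<open>1\<close> at \<open>0\<close>.
\<close>

definition defect_entry :: "nat \<Rightarrow> real" where
  "defect_entry j = (case j of 0 \<Rightarrow> 1 | Suc i \<Rightarrow> sqrt (1 - ratio i))"

definition defect_root :: "(complex \<Rightarrow> 'y) \<Rightarrow> complex \<Rightarrow> 'y" where
  "defect_root f = of_coeffs (\<lambda>j. of_real (defect_entry j) *\<^sub>C tc f j)"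

lemma defect_entry: "0 \<le> defect_entry j" "defect_entry j \<le> 1"
  using ratio[of "j - 1"] by (auto simp: defect_entry_def split: nat.split)

lemma defect_root_taylor:
  assumes f: "f \<in> hcarrier A"
  shows "defect_root f \<in> hcarrier A"
    and "tc (defect_root f) = (\<lambda>j. of_real (defect_entry j) *\<^sub>C tc f j)"
proof -
  have "summable (\<lambda>j. bergman_weight n j * (hnorm Y (of_real (defect_entry j) *\<^sub>C tc f j))\<^sup>2)"
  proof (rule summable_comparison_test')
    show "summable (\<lambda>j. bergman_weight n j * (hnorm Y (tc f j))\<^sup>2)"
      using taylor(1)[OF f] by (simp add: weighted_l2_carrier)
    fix j
    have "(defect_entry j)\<^sup>2 \<le> 1" using defect_entry by (intro power_le_one) auto
    then have "(defect_entry j)\<^sup>2 * (bergman_weight n j * (hnorm Y (tc f j))\<^sup>2)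
        \<le> 1 * (bergman_weight n j * (hnorm Y (tc f j))\<^sup>2)"
      using weight_nonneg by (intro mult_right_mono) auto
    then show "norm (bergman_weight n j * (hnorm Y (of_real (defect_entry j) *\<^sub>C tc f j))\<^sup>2)
        \<le> bergman_weight n j * (hnorm Y (tc f j))\<^sup>2"
      using weight_nonneg[of j] taylor_in[OF f] by (simp add: Y.hnorm_scale power_mult_distrib ac_simps)
  qed
  moreover have "bergman_weight n j \<noteq> 0" for j using weight_pos[of j] by simp
  ultimately have "(\<lambda>j. of_real (defect_entry j) *\<^sub>C tc f j) \<in> hcarrier l2"
    using taylor_in[OF f] by (simp add: weighted_l2_carrier)
  from of_coeffs[OF this] show "defect_root f \<in> hcarrier A"
    "tc (defect_root f) = (\<lambda>j. of_real (defect_entry j) *\<^sub>C tc f j)"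
    by (auto simp: defect_root_def)
qed

lemma defect_root_self_adjoint: "adjoint_pair A A defect_root defect_root"
  unfolding adjoint_pair_def
proof (intro conjI ballI)
  fix f g assume f: "f \<in> hcarrier A" and g: "g \<in> hcarrier A"
  have "hinner Y (tc (defect_root f) j) (tc g j) = hinner Y (tc f j) (tc (defect_root g) j)" for j
    using taylor_in[OF f] taylor_in[OF g]
    by (simp add: defect_root_taylor[OF f] defect_root_taylor[OF g] Y.inner_scale_left Y.inner_scale_right)
  then show "hinner A (defect_root f) g = hinner A f (defect_root g)"
    by (simp add: inner_eq weighted_l2_inner)
qed (use defect_root_taylor in auto)

text \<open>
  This is \<open>I = S S\<^sup>* + E\<^sup>2\<close>: coefficient \<open>j + 1\<close> contributes the fraction \<open>ratio j\<close> of its weight to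
  the first term and the remainder to the second.
\<close>

lemma shift_defect:
  assumes f: "f \<in> hcarrier A"
  shows "(hnorm A f)\<^sup>2 = (hnorm A (shift_adjoint f))\<^sup>2 + (hnorm A (defect_root f))\<^sup>2"
proof -
  let ?g = "\<lambda>j. bergman_weight n j * (hnorm Y (tc f j))\<^sup>2"
  let ?d = "\<lambda>j. bergman_weight n j * (hnorm Y (tc (defect_root f) j))\<^sup>2"
  let ?r = "\<lambda>j. bergman_weight n j * (hnorm Y (tc (shift_adjoint f) j))\<^sup>2"
  have d0: "?d 0 = ?g 0"
    by (simp add: defect_root_taylor[OF f] defect_entry_def scaleC_one)
  have "?r j = ratio j * ?g (Suc j)" for j
    using taylor_in[OF f] ratio(1)[of j]
    by (simp add: shift_adjoint_taylor[OF f] Y.hnorm_scale ratio(3)[symmetric] power_mult_distrib power2_eq_square)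
  moreover have "?d (Suc j) = (1 - ratio j) * ?g (Suc j)" for j
    using taylor_in[OF f] ratio(2)[of j]
    by (simp add: defect_root_taylor[OF f] defect_entry_def Y.hnorm_scale power_mult_distrib)
  ultimately have Suc: "?g (Suc j) = ?r j + ?d (Suc j)" for j
    by (simp only: left_diff_distrib)
  have "(\<lambda>j. ?d (Suc j)) sums ((hnorm A (defect_root f))\<^sup>2 - ?d 0)"
    using hnorm_sums[OF defect_root_taylor(1)[OF f]] by (subst sums_Suc_iff) simp
  from sums_add[OF hnorm_sums[OF shift_adjoint_taylor(1)[OF f]] this]
  have "(\<lambda>j. ?g (Suc j)) sums ((hnorm A (shift_adjoint f))\<^sup>2 + ((hnorm A (defect_root f))\<^sup>2 - ?d 0))"
    unfolding Suc .
  moreover have "(\<lambda>j. ?g (Suc j)) sums ((hnorm A f)\<^sup>2 - ?g 0)"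
    using hnorm_sums[OF f] by (subst sums_Suc_iff) simp
  ultimately show ?thesis using d0 sums_unique2 by fastforce
qed

text \<open>
  Each application of the adjoint shift discards a coefficient and shrinks the others, so the
  norm of the \<open>k\<close>-th iterate is at most the \<open>k\<close>-th tail of the norm series.
\<close>

lemma shift_adjoint_tail:
  assumes f: "f \<in> hcarrier A"
  shows "(shift_adjoint ^^ k) f \<in> hcarrier A \<and>
    (hnorm A ((shift_adjoint ^^ k) f))\<^sup>2 \<le> (\<Sum>j. bergman_weight n (j + k) * (hnorm Y (tc f (j + k)))\<^sup>2)"
  using f
proof (induction k arbitrary: f)
  case 0
  then show ?case using hnorm_sums by (simp add: sums_iff)
next
  case (Suc k)
  let ?R = "shift_adjoint f"
  have R: "?R \<in> hcarrier A" by (rule shift_adjoint_taylor(1)[OF Suc.prems])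
  have sm: "summable (\<lambda>j. bergman_weight n (j + i) * (hnorm Y (tc g (j + i)))\<^sup>2)" if "g \<in> hcarrier A" for g i
    using hnorm_sums[OF that] by (subst summable_iff_shift) (simp add: sums_iff)
  have "(\<Sum>j. bergman_weight n (j + k) * (hnorm Y (tc ?R (j + k)))\<^sup>2)
      \<le> (\<Sum>j. bergman_weight n (j + Suc k) * (hnorm Y (tc f (j + Suc k)))\<^sup>2)"
  proof (rule suminf_le[OF _ sm[OF R] sm[OF Suc.prems]])
    fix j
    let ?i = "j + k"
    have "bergman_weight n ?i * (hnorm Y (tc ?R ?i))\<^sup>2
        = ratio ?i * (bergman_weight n (Suc ?i) * (hnorm Y (tc f (Suc ?i)))\<^sup>2)"
      using taylor_in[OF Suc.prems] ratio(1)[of ?i]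
      by (simp add: shift_adjoint_taylor[OF Suc.prems] Y.hnorm_scale ratio(3)[symmetric]
          power_mult_distrib power2_eq_square)
    also have "\<dots> \<le> 1 * (bergman_weight n (Suc ?i) * (hnorm Y (tc f (Suc ?i)))\<^sup>2)"
      using ratio weight_nonneg by (intro mult_right_mono) auto
    finally show "bergman_weight n ?i * (hnorm Y (tc ?R ?i))\<^sup>2
        \<le> bergman_weight n (j + Suc k) * (hnorm Y (tc f (j + Suc k)))\<^sup>2" by simp
  qed
  then show ?case using Suc.IH[OF R] by (simp only: funpow_Suc_right o_apply) auto
qed

lemma shift_adjoint_pure:
  assumes f: "f \<in> hcarrier A"
  shows "(\<lambda>k. hnorm A ((shift_adjoint ^^ k) f)) \<longlonglongrightarrow> 0"
proof -
  let ?g = "\<lambda>j. bergman_weight n j * (hnorm Y (tc f j))\<^sup>2"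
  have sums: "?g sums (hnorm A f)\<^sup>2" by (rule hnorm_sums[OF f])
  have tail: "(\<Sum>j. ?g (j + k)) = (hnorm A f)\<^sup>2 - (\<Sum>j<k. ?g j)" for k
    using sums suminf_minus_initial_segment[of ?g k] by (simp add: sums_iff)
  have "(\<lambda>k. (hnorm A f)\<^sup>2 - (\<Sum>j<k. ?g j)) \<longlonglongrightarrow> (hnorm A f)\<^sup>2 - (hnorm A f)\<^sup>2"
    using sums by (intro tendsto_diff tendsto_const) (simp add: sums_def)
  then have lim: "(\<lambda>k. \<Sum>j. ?g (j + k)) \<longlonglongrightarrow> 0" unfolding tail by simp
  have "(\<lambda>k. (hnorm A ((shift_adjoint ^^ k) f))\<^sup>2) \<longlonglongrightarrow> 0"
    by (rule Lim_null_comparison[OF _ lim]) (use shift_adjoint_tail[OF f] in simp)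
  from tendsto_real_sqrt[OF this] show ?thesis
    using shift_adjoint_tail[OF f] by simp
qed

end


section \<open>Holomorphic dependence of point evaluation\<close>

context bergman
begin

text \<open>
  These series bound the derivative of point evaluation and the error of its difference quotients.
  They arise from \<open>\<Sum> K\<^sup>j / \<mu>\<^sub>n\<^sub>,\<^sub>j\<close> by termwise differentiation in \<open>K\<close>.
\<close>

lemma derivative_weights_summable:
  assumes K: "0 \<le> K" "K < 1"
  shows "summable (\<lambda>j. 1 / bergman_weight n j * (real j * K ^ (j - 1)))"
    and "summable (\<lambda>j. 1 / bergman_weight n j * (real j * real (j - Suc 0) * K ^ (j - 2)))"
proof -
  let ?c = "\<lambda>j. 1 / bergman_weight n j"
  have 0: "summable (\<lambda>j. ?c j * x ^ j)" if "norm x < 1" for x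
    using bergman_weight_summable[OF n that] .
  have 1: "summable (\<lambda>j. diffs ?c j * x ^ j)" if "norm x < 1" for x
    by (rule termdiff_converges[OF that 0])
  have 2: "summable (\<lambda>j. diffs (diffs ?c) j * x ^ j)" if "norm x < 1" for x
    by (rule termdiff_converges[OF that 1])
  have Kn: "norm K < 1" using K by simp
  have "summable (\<lambda>j. ?c (Suc j) * (real (Suc j) * K ^ (Suc j - 1)))"
    using 1[OF Kn] by (simp add: diffs_def ac_simps)
  then show "summable (\<lambda>j. ?c j * (real j * K ^ (j - 1)))"
    by (subst summable_Suc_iff[symmetric])
  have "summable (\<lambda>j. ?c (j + 2) * (real (j + 2) * real (j + 2 - Suc 0) * K ^ (j + 2 - 2)))"
    using 2[OF Kn] by (simp add: diffs_def ac_simps)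
  then show "summable (\<lambda>j. ?c j * (real j * real (j - Suc 0) * K ^ (j - 2)))"
    by (subst summable_iff_shift[symmetric])
qed

definition derivative_at :: "complex \<Rightarrow> (complex \<Rightarrow> 'y) \<Rightarrow> 'y" where
  "derivative_at z f = (SOME s. hsums Y (\<lambda>j. (of_nat j * z ^ (j - 1)) *\<^sub>C tc f j) s)"

lemma derivative_at:
  assumes f: "f \<in> hcarrier A" and z: "cmod z < 1"
  shows "hsums Y (\<lambda>j. (of_nat j * z ^ (j - 1)) *\<^sub>C tc f j) (derivative_at z f)"
proof -
  have "\<exists>s. hsums Y (\<lambda>j. (of_nat j * z ^ (j - 1)) *\<^sub>C tc f j) s"
    using multiplier_exists[OF f _ derivative_weights_summable(1), of "\<lambda>j. of_nat j * z ^ (j - 1)" "cmod z"] z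
    by (simp add: norm_mult norm_power)
  then show ?thesis unfolding derivative_at_def by (rule someI_ex)
qed

lemma derivative_at_bounded:
  assumes z: "cmod z < 1"
  shows "derivative_at z \<in> bounded_operators A Y"
proof -
  have closed: "derivative_at z f \<in> hcarrier Y" if "f \<in> hcarrier A" for f
    using derivative_at[OF that z] taylor_in[OF that] by (simp add: Y.hsums_iff)
  have "derivative_at z (f + g) = derivative_at z f + derivative_at z g"
    if f: "f \<in> hcarrier A" and g: "g \<in> hcarrier A" for f g
  proof (rule Y.hsums_unique)
    show "hsums Y (\<lambda>j. (of_nat j * z ^ (j - 1)) *\<^sub>C tc (f + g) j) (derivative_at z f + derivative_at z g)"
      using Y.hsums_add[OF _ _ derivative_at[OF f z] derivative_at[OF g z]] taylor_in[OF f] taylor_in[OF g]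
      by (simp add: tc_add[OF f g] scaleC_add_right)
  qed (use derivative_at[OF A.add_closed[OF f g] z] taylor_in[OF A.add_closed[OF f g]] in auto)
  moreover have "derivative_at z (c *\<^sub>C f) = c *\<^sub>C derivative_at z f" if f: "f \<in> hcarrier A" for f c
  proof (rule Y.hsums_unique)
    show "hsums Y (\<lambda>j. (of_nat j * z ^ (j - 1)) *\<^sub>C tc (c *\<^sub>C f) j) (c *\<^sub>C derivative_at z f)"
      unfolding tc_scale[OF f]
      using Y.hsums_scale[OF _ derivative_at[OF f z], of c] taylor_in[OF f]
      by (simp add: scaleC_fun_def scaleC_scaleC ac_simps)
  qed (use derivative_at[OF A.scale_closed[OF f] z] taylor_in[OF A.scale_closed[OF f]] in auto)
  moreover have "hnorm Y (derivative_at z f) \<le>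
      (\<Sum>j. 1 / bergman_weight n j * (real j * cmod z ^ (j - 1))) * hnorm A f" if f: "f \<in> hcarrier A" for f
    by (rule multiplier_bound[OF f derivative_at[OF f z]])
      (use derivative_weights_summable(1)[of "cmod z"] z in \<open>auto simp: norm_mult norm_power\<close>)
  ultimately show ?thesis using closed unfolding bounded_operators_def by blast
qed

text \<open>
  Coefficientwise the error is \<open>(w\<^sup>j - z\<^sup>j) / (w - z) - j z\<^sup>j\<^sup>-\<^sup>1\<close>, of modulus at most
  \<open>j (j - 1) K\<^sup>j\<^sup>-\<^sup>2 \<bar>w - z\<bar>\<close>. The bound is uniform on bounded sets of \<open>f\<close>, which is what
  differentiability in operator norm asks for.
\<close>

lemma difference_quotient_bound:
  assumes f: "f \<in> hcarrier A" and z: "cmod z \<le> K" and w: "cmod w \<le> K" and K: "K < 1" and wz: "w \<noteq> z"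
  shows "hnorm Y (inverse (w - z) *\<^sub>C (f w - f z) - derivative_at z f)
    \<le> (\<Sum>j. 1 / bergman_weight n j * (real j * real (j - Suc 0) * K ^ (j - 2))) * cmod (w - z) * hnorm A f"
proof -
  have K0: "0 \<le> K" using z norm_ge_zero order_trans by blast
  have z1: "cmod z < 1" and w1: "cmod w < 1" using z w K by auto
  define t where "t j = (w ^ j - z ^ j) / (w - z) - of_nat j * z ^ (j - 1)" for j
  have tcY: "tc f j \<in> hcarrier Y" for j by (rule taylor_in[OF f])
  have "hsums Y (\<lambda>j. inverse (w - z) *\<^sub>C (w ^ j *\<^sub>C tc f j - z ^ j *\<^sub>C tc f j) - (of_nat j * z ^ (j - 1)) *\<^sub>C tc f j)
      (inverse (w - z) *\<^sub>C (f w - f z) - derivative_at z f)"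
    by (intro Y.hsums_diff Y.hsums_scale expansion[OF f] derivative_at[OF f] z1 w1) (use tcY in auto)
  moreover have "inverse (w - z) *\<^sub>C (w ^ j *\<^sub>C tc f j - z ^ j *\<^sub>C tc f j) - (of_nat j * z ^ (j - 1)) *\<^sub>C tc f j
      = t j *\<^sub>C tc f j" for j
    by (simp add: t_def complex_vector.scale_left_diff_distrib[symmetric] scaleC_scaleC divide_inverse mult.commute)
  ultimately have s: "hsums Y (\<lambda>j. t j *\<^sub>C tc f j) (inverse (w - z) *\<^sub>C (f w - f z) - derivative_at z f)"
    by simp
  have tb: "cmod (t j) \<le> cmod (w - z) * (real j * real (j - Suc 0) * K ^ (j - 2))" for j
    using lemma_termdiff3[of "w - z" z K j] wz z w by (simp add: t_def ac_simps)
  have sm: "summable (\<lambda>j. 1 / bergman_weight n j * (real j * real (j - Suc 0) * K ^ (j - 2)))"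
    by (rule derivative_weights_summable(2)[OF K0 K])
  have eq: "1 / bergman_weight n j * (cmod (w - z) * (real j * real (j - Suc 0) * K ^ (j - 2)))
      = cmod (w - z) * (1 / bergman_weight n j * (real j * real (j - Suc 0) * K ^ (j - 2)))" for j
    by simp
  have "hnorm Y (inverse (w - z) *\<^sub>C (f w - f z) - derivative_at z f)
      \<le> (\<Sum>j. 1 / bergman_weight n j * (cmod (w - z) * (real j * real (j - Suc 0) * K ^ (j - 2)))) * hnorm A f"
    by (rule multiplier_bound[OF f s tb]) (unfold eq, rule summable_mult[OF sm])
  then show ?thesis unfolding eq suminf_mult[OF sm] by (simp add: mult.commute)
qed

end

lemma operator_norm_le:
  assumes "complex_inner_space H" "complex_inner_space K"
    and T: "\<And>x. x \<in> hcarrier H \<Longrightarrow> T x \<in> hcarrier K \<and> hnorm K (T x) \<le> B * hnorm H x" and B: "B \<ge> 0"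
  shows "0 \<le> operator_norm H K T" "operator_norm H K T \<le> B"
proof -
  interpret H: complex_inner_space H by fact
  interpret K: complex_inner_space K by fact
  let ?S = "{x \<in> hcarrier H. hnorm H x \<le> 1}"
  have 0: "0 \<in> ?S" by simp
  have le: "hnorm K (T x) \<le> B" if "x \<in> ?S" for x
    using T[of x] that mult_left_mono[of "hnorm H x" 1 B] B by auto
  show "operator_norm H K T \<le> B"
    unfolding operator_norm_def by (rule cSUP_least) (use 0 le in blast)+
  have "0 \<le> hnorm K (T 0)" using T[of 0] by simp
  also have "\<dots> \<le> operator_norm H K T"
    unfolding operator_norm_def by (rule cSUP_upper[OF 0 bdd_aboveI2]) (erule le)
  finally show "0 \<le> operator_norm H K T" .
qed

lemma (in bergman) holomorphic_evaluation:
  assumes U: "complex_inner_space U"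
    and closed: "\<And>u. u \<in> hcarrier U \<Longrightarrow> G u \<in> hcarrier A"
    and add: "\<And>u v. u \<in> hcarrier U \<Longrightarrow> v \<in> hcarrier U \<Longrightarrow> G (u + v) = G u + G v"
    and scale: "\<And>c u. u \<in> hcarrier U \<Longrightarrow> G (c *\<^sub>C u) = c *\<^sub>C G u"
    and contr: "\<And>u. u \<in> hcarrier U \<Longrightarrow> hnorm A (G u) \<le> hnorm U u"
  shows "holomorphic_operator_function U Y (\<lambda>z u. G u z)"
proof -
  interpret U: complex_inner_space U by fact
  have bounded: "(\<lambda>u. E (G u)) \<in> bounded_operators U Y" if E: "E \<in> bounded_operators A Y" for E
  proof -
    obtain C where C: "\<And>f. f \<in> hcarrier A \<Longrightarrow> hnorm Y (E f) \<le> C * hnorm A f"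
      using E unfolding bounded_operators_def by blast
    have "hnorm Y (E (G u)) \<le> \<bar>C\<bar> * hnorm U u" if u: "u \<in> hcarrier U" for u
    proof -
      have "hnorm Y (E (G u)) \<le> C * hnorm A (G u)" using C closed[OF u] by simp
      also have "\<dots> \<le> \<bar>C\<bar> * hnorm U u"
        using contr[OF u] closed[OF u] by (intro mult_mono) auto
      finally show ?thesis .
    qed
    then show ?thesis using E closed add scale unfolding bounded_operators_def by auto
  qed
  have "(\<lambda>f. f z) \<in> bounded_operators A Y" if "cmod z < 1" for z
    using evaluation_bound[OF that] value_in by (auto simp: bounded_operators_def scaleC_fun_def)
  then have "(\<lambda>u. G u z) \<in> bounded_operators U Y" if "z \<in> unit_disk" for z
    using bounded[of "\<lambda>f. f z"] that by simp
  moreover have "\<exists>D\<in>bounded_operators U Y.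
      ((\<lambda>w. operator_norm U Y (inverse (w - z) *\<^sub>C ((\<lambda>u. G u w) - (\<lambda>u. G u z)) - D)) \<longlongrightarrow> 0) (at z)"
    if "z \<in> unit_disk" for z
  proof (rule bexI)
    have z: "cmod z < 1" using that by simp
    show "(\<lambda>u. derivative_at z (G u)) \<in> bounded_operators U Y"
      by (rule bounded[OF derivative_at_bounded[OF z]])
    \<comment> \<open>Room between \<open>z\<close> and the unit circle: the error bound is uniform for \<open>w\<close> in the disk of radius \<open>K\<close>.\<close>
    define K where "K = (1 + cmod z) / 2"
    have K: "cmod z < K" "K < 1" using z by (auto simp: K_def)
    define C where "C = (\<Sum>j. 1 / bergman_weight n j * (real j * real (j - Suc 0) * K ^ (j - 2)))"
    have K0: "0 \<le> K" using K norm_ge_zero[of z] by linarith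
    have C: "C \<ge> 0" unfolding C_def
      using weight_nonneg K0 by (intro suminf_nonneg derivative_weights_summable(2) K) auto
    let ?Q = "\<lambda>w. inverse (w - z) *\<^sub>C ((\<lambda>u. G u w) - (\<lambda>u. G u z)) - (\<lambda>u. derivative_at z (G u))"
    have near: "0 \<le> operator_norm U Y (?Q w)" "operator_norm U Y (?Q w) \<le> C * cmod (w - z)"
      if w: "cmod w < K" "w \<noteq> z" for w
    proof -
      have "?Q w u \<in> hcarrier Y \<and> hnorm Y (?Q w u) \<le> C * cmod (w - z) * hnorm U u"
        if u: "u \<in> hcarrier U" for u
      proof
        have Q: "?Q w u = inverse (w - z) *\<^sub>C (G u w - G u z) - derivative_at z (G u)"
          by (simp add: scaleC_fun_def)
        have "derivative_at z (G u) \<in> hcarrier Y"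
          using derivative_at_bounded[OF z] closed[OF u] by (simp add: bounded_operators_def)
        then show "?Q w u \<in> hcarrier Y" unfolding Q using value_in[OF closed[OF u]] by simp
        have "hnorm Y (?Q w u) \<le> C * cmod (w - z) * hnorm A (G u)"
          unfolding Q C_def using difference_quotient_bound[OF closed[OF u], of z K w] w K by simp
        also have "\<dots> \<le> C * cmod (w - z) * hnorm U u"
          using contr[OF u] C by (intro mult_left_mono) auto
        finally show "hnorm Y (?Q w u) \<le> C * cmod (w - z) * hnorm U u" .
      qed
      note le = operator_norm_le[OF U Y.complex_inner_space_axioms, of "?Q w", OF this]
      show "0 \<le> operator_norm U Y (?Q w)" "operator_norm U Y (?Q w) \<le> C * cmod (w - z)"
        using C by (auto intro!: le simp del: minus_apply)
    qed
    show "((\<lambda>w. operator_norm U Y (?Q w)) \<longlongrightarrow> 0) (at z)"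
    proof (rule Lim_null_comparison)
      have "((\<lambda>w. C * cmod (w - z)) \<longlongrightarrow> C * cmod (z - z)) (at z)"
        by (intro tendsto_intros)
      then show "((\<lambda>w. C * cmod (w - z)) \<longlongrightarrow> 0) (at z)" by simp
      have "\<forall>\<^sub>F w in at z. w \<in> ball 0 K \<and> w \<noteq> z"
        using K by (intro eventually_conj eventually_neq_at_within eventually_at_in_open') auto
      then show "\<forall>\<^sub>F w in at z. norm (operator_norm U Y (?Q w)) \<le> C * cmod (w - z)"
        by eventually_elim (use near in simp)
    qed
  qed
  ultimately show ?thesis unfolding holomorphic_operator_function_def by blast
qed


section \<open>The restriction of the shift to an invariant subspace\<close>

lemma bergman_shift_power: "(bergman_shift ^^ k) f z = z ^ k *\<^sub>C f z"
  by (induction k) (simp_all add: bergman_shift_def scaleC_one scaleC_scaleC)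

lemma sum_fun_apply: "(\<Sum>i\<in>I. f i) z = (\<Sum>i\<in>I. f i z)"
  by (induction I rule: infinite_finite_induct) simp_all

text \<open>
  Elements of \<open>U\<close> are pairs of functions on the disk, but have to be single functions on the
  plane. The second component is therefore moved to the disjoint disk around \<open>3\<close>.
\<close>

definition pair_encode :: "(nat \<Rightarrow> complex \<Rightarrow> 'y::complex_vector) \<Rightarrow> complex \<Rightarrow> 'y" where
  "pair_encode a = (\<lambda>z. a 0 z + a 1 (z - 3))"

definition pair_decode :: "(complex \<Rightarrow> 'y::complex_vector) \<Rightarrow> nat \<Rightarrow> complex \<Rightarrow> 'y" where
  "pair_decode u i = (\<lambda>z. if cmod z < 1 \<and> i < 2 then u (z + 3 * of_nat i) else 0)"

abbreviation two_copies :: "'v::complex_vector hilbert \<Rightarrow> (nat \<Rightarrow> 'v) hilbert" where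
  "two_copies H \<equiv> weighted_l2 (\<lambda>i. if i < 2 then 1 else 0) H"

lemma (in complex_inner_space) two_copies_carrier:
  "a \<in> hcarrier (two_copies H) \<longleftrightarrow> (\<forall>i<2. a i \<in> hcarrier H) \<and> (\<forall>i\<ge>2. a i = 0)"
proof -
  have "summable (\<lambda>j. (if j < 2 then 1 else 0) * (hnorm H (a j))\<^sup>2)"
    by (rule summable_finite[of "{..<2}"]) auto
  moreover have "(\<forall>j. a j \<in> hcarrier H) \<longleftrightarrow> (\<forall>i<2. a i \<in> hcarrier H)" if "\<forall>i\<ge>2. a i = 0"
    using that by (metis not_less zero_closed)
  ultimately show ?thesis unfolding weighted_l2_carrier by auto
qed

lemma (in complex_inner_space) two_copies_inner:
  "hinner (two_copies H) a b = hinner H (a 0) (b 0) + hinner H (a 1) (b 1)"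
proof -
  have "hinner (two_copies H) a b = (\<Sum>j<2. of_real (if j < 2 then 1 else 0) * hinner H (a j) (b j))"
    unfolding weighted_l2_inner by (rule suminf_finite) auto
  then show ?thesis by (simp add: numeral_2_eq_2)
qed

locale invariant_subspace = bergman +
  fixes M :: "(complex \<Rightarrow> 'a) set"
  assumes M: "closed_subspace A M" and invariant: "bergman_shift ` M \<subseteq> M"
begin

abbreviation "K \<equiv> A\<lparr>hcarrier := M\<rparr>"

sublocale K: complex_hilbert_space K
  by (rule A.closed_subspace_hilbert[OF M])

lemma M_subset: "f \<in> M \<Longrightarrow> f \<in> hcarrier A"
  using M by (auto simp: closed_subspace_def)

lemma hnorm_K: "hnorm K f = hnorm A f"
  by (simp add: hnorm_def)

definition proj :: "(complex \<Rightarrow> 'a) \<Rightarrow> complex \<Rightarrow> 'a" where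
  "proj f = (SOME p. p \<in> M \<and> (\<forall>m\<in>M. hinner A (f - p) m = 0))"

lemma proj:
  assumes f: "f \<in> hcarrier A"
  shows "proj f \<in> M" and "m \<in> M \<Longrightarrow> hinner A (f - proj f) m = 0"
proof -
  have "\<exists>p. p \<in> M \<and> (\<forall>m\<in>M. hinner A (f - p) m = 0)"
    using A.projection_exists[OF M f] by blast
  then have "proj f \<in> M \<and> (\<forall>m\<in>M. hinner A (f - proj f) m = 0)"
    unfolding proj_def by (rule someI_ex)
  then show "proj f \<in> M" and "m \<in> M \<Longrightarrow> hinner A (f - proj f) m = 0" by auto
qed

lemma proj_inner: "f \<in> hcarrier A \<Longrightarrow> m \<in> M \<Longrightarrow> hinner A (proj f) m = hinner A f m"
  using proj[of f] M_subset by (simp add: A.inner_diff_left)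

lemma proj_in: "f \<in> hcarrier A \<Longrightarrow> proj f \<in> hcarrier A"
  using proj M_subset by blast

lemma proj_self_adjoint: "adjoint_pair A A proj proj"
  unfolding adjoint_pair_def
proof (intro conjI ballI)
  fix f g assume f: "f \<in> hcarrier A" and g: "g \<in> hcarrier A"
  have "hinner A (proj f) g = cnj (hinner A g (proj f))"
    by (rule A.inner_cnj[OF g proj_in[OF f]])
  also have "hinner A g (proj f) = hinner A (proj g) (proj f)"
    using proj_inner[OF g proj(1)[OF f]] by simp
  also have "cnj \<dots> = hinner A (proj f) (proj g)"
    by (rule A.inner_cnj[OF proj_in[OF g] proj_in[OF f], symmetric])
  also have "\<dots> = hinner A f (proj g)"
    by (rule proj_inner[OF f proj(1)[OF g]])
  finally show "hinner A (proj f) g = hinner A f (proj g)" .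
qed (use proj_in in auto)

lemma pythagoras:
  assumes f: "f \<in> hcarrier A"
  shows "(hnorm A f)\<^sup>2 = (hnorm A (proj f))\<^sup>2 + (hnorm A (f - proj f))\<^sup>2"
proof -
  have "hinner A (f - proj f) (proj f) = 0" by (rule proj(2)[OF f proj(1)[OF f]])
  then show ?thesis
    using A.hnorm_add_sq[of "f - proj f" "proj f"] f proj_in[OF f] by simp
qed

definition U :: "(complex \<Rightarrow> 'a) hilbert" where
  "U = \<lparr>hcarrier = pair_encode ` hcarrier (two_copies A),
        hinner = (\<lambda>u v. hinner (two_copies A) (pair_decode u) (pair_decode v))\<rparr>"

lemma pair_decode_encode:
  assumes a: "a \<in> hcarrier (two_copies A)"
  shows "pair_decode (pair_encode a) = a"
proof (intro ext)
  fix i z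
  have far: "\<not> cmod (z - 3) < 1" "\<not> cmod (z + 3) < 1" if "cmod z < 1"
    using that norm_triangle_ineq2[of 3 z] norm_triangle_ineq2[of 3 "-z"]
    by (simp_all add: norm_minus_commute add.commute)
  have A: "a 0 \<in> hcarrier A" "a 1 \<in> hcarrier A" and 0: "i \<ge> 2 \<Longrightarrow> a i = 0"
    using a by (simp_all add: A.two_copies_carrier)
  consider "i = 0" | "i = 1" | "i \<ge> 2" by linarith
  then show "pair_decode (pair_encode a) i z = a i z"
    using far value_outside[OF A(1)] value_outside[OF A(2)] 0
    by cases (auto simp: pair_decode_def pair_encode_def)
qed

lemma U_hilbert: "complex_hilbert_space U"
proof (rule complex_hilbert_space_isomorphic)
  show "complex_hilbert_space (two_copies A)"
    by (rule complex_hilbert_space_weighted_l2[OF A.complex_hilbert_space_axioms]) simp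
  show "pair_encode ` hcarrier (two_copies A) = hcarrier U" by (simp add: U_def)
  show "hinner U (pair_encode a) (pair_encode b) = hinner (two_copies A) a b"
    if "a \<in> hcarrier (two_copies A)" "b \<in> hcarrier (two_copies A)" for a b
    using that by (simp add: U_def pair_decode_encode)
qed (simp_all add: pair_encode_def scaleC_fun_def fun_eq_iff scaleC_add_right)

sublocale U: complex_hilbert_space U by (rule U_hilbert)

lemma U_decode: "u \<in> hcarrier U \<Longrightarrow> pair_decode u \<in> hcarrier (two_copies A)"
  using pair_decode_encode by (auto simp: U_def)

lemma U_encode: "a \<in> hcarrier (two_copies A) \<Longrightarrow> pair_encode a \<in> hcarrier U"
  by (simp add: U_def)

lemma U_decode_in: "u \<in> hcarrier U \<Longrightarrow> pair_decode u 0 \<in> hcarrier A"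
  "u \<in> hcarrier U \<Longrightarrow> pair_decode u 1 \<in> hcarrier A"
  using U_decode[of u] by (auto simp: A.two_copies_carrier)

text \<open>
  \<open>G (a, b) = P (E a + S (I - P) b)\<close>, and \<open>D\<close> is its adjoint.
\<close>

definition G :: "(complex \<Rightarrow> 'a) \<Rightarrow> complex \<Rightarrow> 'a" where
  "G u = proj (defect_root (pair_decode u 0) + bergman_shift (pair_decode u 1 - proj (pair_decode u 1)))"

definition D_pair :: "(complex \<Rightarrow> 'a) \<Rightarrow> nat \<Rightarrow> complex \<Rightarrow> 'a" where
  "D_pair f i = (if i = 0 then defect_root f
     else if i = 1 then shift_adjoint f - proj (shift_adjoint f) else 0)"

definition D :: "(complex \<Rightarrow> 'a) \<Rightarrow> complex \<Rightarrow> 'a" where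
  "D f = pair_encode (D_pair f)"

lemma D_pair_in: "f \<in> hcarrier A \<Longrightarrow> D_pair f \<in> hcarrier (two_copies A)"
  using defect_root_taylor(1) shift_adjoint_taylor(1) proj_in
  by (auto simp: A.two_copies_carrier D_pair_def)

lemma G_adjoint: "adjoint_pair U K G D"
  unfolding adjoint_pair_def
proof (intro conjI ballI)
  fix u assume u: "u \<in> hcarrier U"
  define a b where "a = pair_decode u 0" and "b = pair_decode u 1"
  have ab: "a \<in> hcarrier A" "b \<in> hcarrier A" using U_decode_in[OF u] by (auto simp: a_def b_def)
  have sum: "defect_root a + bergman_shift (b - proj b) \<in> hcarrier A"
    using ab defect_root_taylor(1) shift_taylor(1) proj_in by simp
  then show "G u \<in> hcarrier K" using proj(1) by (simp add: G_def a_def b_def)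
  fix f assume "f \<in> hcarrier K"
  then have fM: "f \<in> M" and f: "f \<in> hcarrier A" using M_subset by auto
  let ?r = "shift_adjoint f"
  have r: "?r \<in> hcarrier A" by (rule shift_adjoint_taylor(1)[OF f])
  have "hinner K (G u) f = hinner A (defect_root a + bergman_shift (b - proj b)) f"
    using proj_inner[OF sum fM] by (simp add: G_def a_def b_def)
  also have "\<dots> = hinner A (defect_root a) f + hinner A (bergman_shift (b - proj b)) f"
    using ab defect_root_taylor(1) shift_taylor(1) proj_in f by (simp add: A.inner_add_left)
  also have "hinner A (defect_root a) f = hinner A a (defect_root f)"
    by (rule adjoint_pair_inner[OF defect_root_self_adjoint ab(1) f])
  also have "hinner A (bergman_shift (b - proj b)) f = hinner A (b - proj b) ?r"
    using ab proj_in by (intro adjoint_pair_inner[OF shift_adjoint_pair _ f]) simp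
  also have "\<dots> = hinner A b (?r - proj ?r)"
    using ab r proj_in adjoint_pair_inner[OF proj_self_adjoint ab(2) r]
    by (simp add: A.inner_diff_left A.inner_diff_right)
  also have "hinner A a (defect_root f) + hinner A b (?r - proj ?r) = hinner U u (D f)"
    using pair_decode_encode[OF D_pair_in[OF f]]
    by (simp add: U_def D_def A.two_copies_inner D_pair_def a_def b_def)
  finally show "hinner K (G u) f = hinner U u (D f)" .
qed (use D_pair_in M_subset U_encode in \<open>auto simp: D_def\<close>)

lemma D_hnorm:
  assumes f: "f \<in> hcarrier A"
  shows "(hnorm U (D f))\<^sup>2 = (hnorm A (defect_root f))\<^sup>2 + (hnorm A (shift_adjoint f - proj (shift_adjoint f)))\<^sup>2"
proof -
  have Df: "D f \<in> hcarrier U" using D_pair_in[OF f] U_encode by (simp add: D_def)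
  have "hinner U (D f) (D f) = hinner A (defect_root f) (defect_root f)
      + hinner A (shift_adjoint f - proj (shift_adjoint f)) (shift_adjoint f - proj (shift_adjoint f))"
    using pair_decode_encode[OF D_pair_in[OF f]]
    by (simp add: U_def D_def A.two_copies_inner D_pair_def)
  then show ?thesis
    using Df f defect_root_taylor(1) shift_adjoint_taylor(1) proj_in
    by (simp add: U.hnorm_sq A.hnorm_sq)
qed

text \<open>
  \<open>P S\<^sup>*\<close> and \<open>S\<^sup>*\<close> differ on \<open>M\<close> by a vector orthogonal to \<open>M\<close>.
\<close>

lemma restricted_shift_adjoint: "adjoint_pair K K bergman_shift (proj \<circ> shift_adjoint)"
  unfolding adjoint_pair_def
proof (intro conjI ballI)
  fix f g assume "f \<in> hcarrier K" "g \<in> hcarrier K"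
  then have f: "f \<in> M" "f \<in> hcarrier A" and g: "g \<in> hcarrier A" using M_subset by auto
  have r: "shift_adjoint g \<in> hcarrier A" by (rule shift_adjoint_taylor(1)[OF g])
  have "hinner A (bergman_shift f) g = hinner A f (shift_adjoint g)"
    by (rule adjoint_pair_inner[OF shift_adjoint_pair f(2) g])
  also have "\<dots> = cnj (hinner A (shift_adjoint g) f)"
    by (rule A.inner_cnj[OF r f(2)])
  also have "\<dots> = cnj (hinner A (proj (shift_adjoint g)) f)"
    using proj_inner[OF r f(1)] by simp
  also have "\<dots> = hinner A f (proj (shift_adjoint g))"
    by (rule A.inner_cnj[OF proj_in[OF r] f(2), symmetric])
  finally show "hinner K (bergman_shift f) g = hinner K f ((proj \<circ> shift_adjoint) g)" by simp
qed (use invariant proj(1) shift_adjoint_taylor(1) M_subset in auto)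

text \<open>
  For \<open>f\<close> in \<open>M\<close>, \<open>\<parallel>f\<parallel>\<^sup>2 = \<parallel>E f\<parallel>\<^sup>2 + \<parallel>S\<^sup>* f\<parallel>\<^sup>2\<close>, and the last term splits along \<open>P\<close> into
  \<open>\<parallel>T\<^sup>* f\<parallel>\<^sup>2\<close> and the second component of \<open>D f\<close>. The powers of \<open>T\<^sup>*\<close> inherit their decay from those
  of \<open>S\<^sup>*\<close>: \<open>T\<^sup>k\<close> agrees with \<open>S\<^sup>k\<close> on \<open>M\<close>, so \<open>p = T\<^sup>*\<^sup>k f\<close> satisfies
  \<open>\<parallel>p\<parallel>\<^sup>2 = \<langle>S\<^sup>k p, f\<rangle> = \<langle>p, S\<^sup>*\<^sup>k f\<rangle>\<close>.
\<close>

sublocale pure_contraction K U bergman_shift "proj \<circ> shift_adjoint" G D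
proof
  show "adjoint_pair K K bergman_shift (proj \<circ> shift_adjoint)" by (rule restricted_shift_adjoint)
  show "adjoint_pair U K G D" by (rule G_adjoint)
  fix f assume fK: "f \<in> hcarrier K"
  then have fM: "f \<in> M" and f: "f \<in> hcarrier A" using M_subset by auto
  show "(hnorm K f)\<^sup>2 = (hnorm K ((proj \<circ> shift_adjoint) f))\<^sup>2 + (hnorm U (D f))\<^sup>2"
    using shift_defect[OF f] pythagoras[OF shift_adjoint_taylor(1)[OF f]]
    by (simp add: hnorm_K D_hnorm[OF f])
  have le: "hnorm A (((proj \<circ> shift_adjoint) ^^ k) f) \<le> hnorm A ((shift_adjoint ^^ k) f)" for k
  proof -
    let ?p = "((proj \<circ> shift_adjoint) ^^ k) f"
    have pM: "?p \<in> M"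
      using adjoint_pair_closed(2)[OF adjoint_pair_funpow[OF restricted_shift_adjoint] fK] by simp
    then have p: "?p \<in> hcarrier A" by (rule M_subset)
    have r: "(shift_adjoint ^^ k) f \<in> hcarrier A"
      using shift_adjoint_tail[OF f] by blast
    have "hinner A ?p ?p = hinner A ((bergman_shift ^^ k) ?p) f"
      using adjoint_pair_inner[OF adjoint_pair_funpow[OF restricted_shift_adjoint, of k], of ?p f] pM fM by simp
    also have "\<dots> = hinner A ?p ((shift_adjoint ^^ k) f)"
      by (rule adjoint_pair_inner[OF adjoint_pair_funpow[OF shift_adjoint_pair] p f])
    finally have "(hnorm A ?p)\<^sup>2 = Re (hinner A ?p ((shift_adjoint ^^ k) f))"
      using p by (simp add: A.hnorm_sq)
    also have "\<dots> \<le> hnorm A ?p * hnorm A ((shift_adjoint ^^ k) f)"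
      using A.cauchy_schwarz[OF p r] complex_Re_le_cmod order_trans by blast
    finally have le: "hnorm A ?p * hnorm A ?p \<le> hnorm A ?p * hnorm A ((shift_adjoint ^^ k) f)"
      by (simp add: power2_eq_square)
    show ?thesis
    proof (cases "hnorm A ?p = 0")
      case True
      then show ?thesis using r by simp
    next
      case False
      then have "hnorm A ?p > 0" using A.hnorm_nonneg[OF p] by linarith
      then show ?thesis using le by simp
    qed
  qed
  have p: "((proj \<circ> shift_adjoint) ^^ k) f \<in> hcarrier A" for k
    using adjoint_pair_closed(2)[OF adjoint_pair_funpow[OF restricted_shift_adjoint] fK] M_subset by simp
  show "(\<lambda>k. hnorm K (((proj \<circ> shift_adjoint) ^^ k) f)) \<longlonglongrightarrow> 0"
    unfolding hnorm_K
    by (rule Lim_null_comparison[OF _ shift_adjoint_pure[OF f]]) (use le p in simp)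
qed

sublocale G: adjoint_operators U K G D
  by unfold_locales (rule G_adjoint)

lemma G_in: "u \<in> hcarrier U \<Longrightarrow> G u \<in> hcarrier A"
  using G.closed(1) M_subset by simp

lemma G_contractive: "u \<in> hcarrier U \<Longrightarrow> hnorm A (G u) \<le> hnorm U u"
proof -
  assume u: "u \<in> hcarrier U"
  have "hnorm K (G u) \<le> hnorm U u"
  proof (rule G.contractive[OF _ u])
    fix f assume f: "f \<in> hcarrier K"
    have le: "(hnorm U (D f))\<^sup>2 \<le> (hnorm K f)\<^sup>2" using defect[OF f] by simp
    show "hnorm U (D f) \<le> hnorm K f" using power2_le_imp_le[OF le] f by simp
  qed
  then show ?thesis by (simp add: hnorm_K)
qed

lemma G_holomorphic: "holomorphic_operator_function U Y (\<lambda>z u. G u z)"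
  using holomorphic_evaluation[OF U.complex_inner_space_axioms G_in G.additive G.homogeneous G_contractive]
  by simp

sublocale HU: bergman U 1
  by unfold_locales simp

lemma HU_l2: "HU.l2 = l2U"
proof -
  have "bergman_weight 1 = (\<lambda>_. 1)" by (simp add: fun_eq_iff)
  then show ?thesis by (simp only:)
qed

text \<open>
  Evaluation at \<open>z\<close> is continuous and turns the series \<open>\<Sum> S\<^sup>k G h\<^sub>k\<close> into \<open>\<Sum> z\<^sup>k (G h\<^sub>k)(z)\<close>. By
  linearity and continuity of \<open>G\<close>, this is the value at \<open>z\<close> of \<open>G (\<Sum> z\<^sup>k h\<^sub>k) = G (h(z))\<close>.
\<close>

lemma control_multiplier:
  assumes h: "h \<in> hcarrier (bergman_space 1 U)" and z: "cmod z < 1"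
  shows "control (HU.tc h) z = G (h z) z"
proof -
  let ?a = "HU.tc h"
  have a: "?a \<in> hcarrier l2U" using HU.taylor(1)[OF h] by (simp only: HU_l2)
  have aU: "?a k \<in> hcarrier U" for k by (rule HU.taylor_in[OF h])
  obtain C where C: "\<And>f. f \<in> hcarrier A \<Longrightarrow> hnorm Y (f z) \<le> C * hnorm A f"
    using evaluation_bound[OF z] by blast
  let ?v = "\<lambda>N. \<Sum>k<N. z ^ k *\<^sub>C ?a k"
  have vU: "?v N \<in> hcarrier U" for N using aU by simp
  have hz: "h z \<in> hcarrier U" by (rule HU.value_in[OF h])
  have cs: "control_sum N ?a z = G (?v N) z" for N
  proof -
    have "G (?v N) = (\<Sum>k<N. z ^ k *\<^sub>C G (?a k))"
    proof (induction N)
      case (Suc N)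
      have "G (?v (Suc N)) = G (?v N) + G (z ^ N *\<^sub>C ?a N)"
        unfolding sum.lessThan_Suc using aU by (intro G.additive) auto
      also have "G (z ^ N *\<^sub>C ?a N) = z ^ N *\<^sub>C G (?a N)" by (rule G.homogeneous[OF aU])
      finally show ?case unfolding Suc sum.lessThan_Suc .
    qed (simp only: lessThan_0 sum.empty G.zero)
    then show ?thesis
      by (simp add: control_sum_def sum_fun_apply bergman_shift_power scaleC_fun_def)
  qed
  have csA: "control_sum N ?a \<in> hcarrier A" for N
    using control_sum_closed[OF a] M_subset by simp
  have cA: "control ?a \<in> hcarrier A" using control(1)[OF a] M_subset by simp
  show ?thesis
  proof (rule Y.limit_unique)
    show "control_sum N ?a z \<in> hcarrier Y" for N by (rule value_in[OF csA])
    show "control ?a z \<in> hcarrier Y" by (rule value_in[OF cA])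
    show "G (h z) z \<in> hcarrier Y" by (rule value_in[OF G_in[OF hz]])
    show "(\<lambda>N. hnorm Y (control_sum N ?a z - control ?a z)) \<longlonglongrightarrow> 0"
    proof (rule Lim_null_comparison)
      show "(\<lambda>N. C * hnorm A (control_sum N ?a - control ?a)) \<longlonglongrightarrow> 0"
        using tendsto_mult_left[OF control(2)[OF a], of C] by (simp add: hnorm_K)
      show "\<forall>\<^sub>F N in sequentially. norm (hnorm Y (control_sum N ?a z - control ?a z))
          \<le> C * hnorm A (control_sum N ?a - control ?a)"
        using C[OF A.diff_closed[OF csA cA]] value_in[OF csA] value_in[OF cA]
        by (intro always_eventually) simp
    qed
    show "(\<lambda>N. hnorm Y (control_sum N ?a z - G (h z) z)) \<longlonglongrightarrow> 0"
    proof (rule Lim_null_comparison)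
      have "(\<lambda>N. hnorm U (?v N - h z)) \<longlonglongrightarrow> 0"
        using HU.expansion[OF h z] aU by (simp add: U.hsums_iff)
      from tendsto_mult_left[OF this, of "\<bar>C\<bar>"]
      show "(\<lambda>N. \<bar>C\<bar> * hnorm U (?v N - h z)) \<longlonglongrightarrow> 0" by simp
      have "hnorm Y (control_sum N ?a z - G (h z) z) \<le> \<bar>C\<bar> * hnorm U (?v N - h z)" for N
      proof -
        have d: "?v N - h z \<in> hcarrier U" using vU hz by simp
        have "control_sum N ?a z - G (h z) z = G (?v N - h z) z"
          unfolding cs using G.diff[OF vU hz] by simp
        also have "hnorm Y \<dots> \<le> C * hnorm A (G (?v N - h z))" by (rule C[OF G_in[OF d]])
        also have "\<dots> \<le> \<bar>C\<bar> * hnorm U (?v N - h z)"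
          using G_contractive[OF d] G_in[OF d] by (intro mult_mono) auto
        finally show ?thesis .
      qed
      then show "\<forall>\<^sub>F N in sequentially. norm (hnorm Y (control_sum N ?a z - G (h z) z)) \<le> \<bar>C\<bar> * hnorm U (?v N - h z)"
        using value_in[OF csA] value_in[OF G_in[OF hz]] by (intro always_eventually) simp
    qed
  qed
qed

end


section \<open>Invariant subspaces as ranges of partially isometric multipliers\<close>

lemma complex_hilbert_space_imp_inner: "complex_hilbert_space H \<Longrightarrow> complex_inner_space H"
proof -
  assume "complex_hilbert_space H"
  then interpret complex_hilbert_space H .
  show "complex_inner_space H" by (rule complex_inner_space_axioms)
qed

definition trivial_hilbert :: "'v::complex_vector hilbert" where
  "trivial_hilbert = \<lparr>hcarrier = {0}, hinner = (\<lambda>_ _. 0)\<rparr>"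

lemma complex_hilbert_space_trivial: "complex_hilbert_space (trivial_hilbert :: 'v::complex_vector hilbert)"
proof (rule complex_hilbert_spaceI)
  show "complex_inner_space (trivial_hilbert :: 'v::complex_vector hilbert)"
    by unfold_locales (auto simp: trivial_hilbert_def complex_vector.subspace_def)
qed (auto simp: trivial_hilbert_def hnorm_def)

theorem theorem7p1:
  fixes n :: nat
    and Y :: "'y::complex_vector hilbert"
    and M :: "(complex \<Rightarrow> 'y) set"
  assumes "n \<ge> 1"
    and "complex_hilbert_space Y"
    and "closed_subspace (bergman_space n Y) M"
    and "bergman_shift ` M \<subseteq> M"
  shows "\<exists>(U :: nat \<Rightarrow> (complex \<Rightarrow> 'y) hilbert) (F :: nat \<Rightarrow> complex \<Rightarrow> (complex \<Rightarrow> 'y) \<Rightarrow> 'y).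
      (\<forall>j\<in>{1..n}. complex_hilbert_space (U j)) \<and>
      (\<forall>j\<in>{1..n}. holomorphic_operator_function (U j) Y (F j)) \<and>
      partial_isometry (direct_sum {1..n} (\<lambda>j. bergman_space j (U j))) (bergman_space n Y)
        (row_multiplier n F) \<and>
      M = row_multiplier n F ` hcarrier (direct_sum {1..n} (\<lambda>j. bergman_space j (U j)))"
proof -
  interpret Y: complex_hilbert_space Y by fact
  interpret X: invariant_subspace Y n M by unfold_locales (use assms in auto)
  define U where "U j = (if j = 1 then X.U else trivial_hilbert)" for j :: nat
  define F where "F j z u = (if j = 1 then X.G u z else 0)" for j :: nat and z u
  let ?B = "direct_sum {1..n} (\<lambda>j. bergman_space j (U j))"
  have U: "complex_hilbert_space (U j)" for j
    by (simp add: U_def X.U_hilbert complex_hilbert_space_trivial)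
  have F: "holomorphic_operator_function (U j) Y (F j)" for j
  proof (cases "j = 1")
    case True
    moreover have "F 1 = (\<lambda>z u. X.G u z)" by (simp add: F_def fun_eq_iff)
    ultimately show ?thesis using X.G_holomorphic by (simp add: U_def)
  next
    case False
    interpret Z: complex_hilbert_space "trivial_hilbert :: (complex \<Rightarrow> 'y) hilbert"
      by (rule complex_hilbert_space_trivial)
    have "holomorphic_operator_function trivial_hilbert Y (\<lambda>z u. (0 :: (complex \<Rightarrow> 'y) \<Rightarrow> complex \<Rightarrow> 'y) u z)"
      by (rule X.holomorphic_evaluation[where G = 0]) (simp_all add: Z.complex_inner_space_axioms)
    moreover have "F j = (\<lambda>z u. (0 :: (complex \<Rightarrow> 'y) \<Rightarrow> complex \<Rightarrow> 'y) u z)"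
      using False by (simp add: F_def fun_eq_iff)
    ultimately show ?thesis using False by (simp add: U_def)
  qed
  have bergman: "bergman (U j) j" if "j \<in> {1..n}" for j
    using U that by (intro bergman.intro bergman_axioms.intro) auto
  interpret B: complex_inner_space ?B
    by (rule complex_inner_space_direct_sum)
      (auto intro!: complex_hilbert_space_imp_inner bergman.hilbert bergman)
  have inner_B: "hinner ?B x y = hinner (bergman_space 1 X.U) (x 1) (y 1)" for x y
  proof -
    have "hinner (bergman_space j (U j)) f g = 0" if "j \<noteq> 1" for j f g
      using that by (simp add: bergman_space_def U_def trivial_hilbert_def)
    then have "(\<Sum>j=1..n. hinner (bergman_space j (U j)) (x j) (y j))
        = (\<Sum>j\<in>{1}. hinner (bergman_space j (U j)) (x j) (y j))"
      using assms(1) by (intro sum.mono_neutral_right) auto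
    moreover have "hinner ?B x y = (\<Sum>j=1..n. hinner (bergman_space j (U j)) (x j) (y j))"
      by (simp add: direct_sum_def)
    ultimately show ?thesis by (simp add: U_def)
  qed
  have x1: "x 1 \<in> hcarrier (bergman_space 1 X.U)" if "x \<in> hcarrier ?B" for x
  proof -
    have "x 1 \<in> hcarrier (bergman_space 1 (U 1))"
      using that assms(1) by (simp add: direct_sum_def)
    then show ?thesis by (simp add: U_def)
  qed
  have row: "row_multiplier n F x = X.control (X.HU.tc (x 1))" if x: "x \<in> hcarrier ?B" for x
  proof
    fix z
    have a: "X.HU.tc (x 1) \<in> hcarrier X.l2U"
      using X.HU.taylor(1)[OF x1[OF x]] by (simp only: X.HU_l2)
    show "row_multiplier n F x z = X.control (X.HU.tc (x 1)) z"
    proof (cases "cmod z < 1")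
      case True
      have "(\<Sum>j=1..n. F j z (x j z)) = (\<Sum>j\<in>{1}. F j z (x j z))"
        using assms(1) by (intro sum.mono_neutral_right) (auto simp: F_def)
      moreover have "row_multiplier n F x z = (\<Sum>j=1..n. F j z (x j z))"
        using True by (simp add: row_multiplier_def)
      ultimately show ?thesis using X.control_multiplier[OF x1[OF x] True] by (simp add: F_def)
    next
      case False
      then show ?thesis
        using X.value_outside[OF X.M_subset, of "X.control (X.HU.tc (x 1))"] X.control(1)[OF a]
        by (simp add: row_multiplier_def)
    qed
  qed
  \<comment> \<open>The isometry from \<open>M\<close> into the direct sum whose adjoint is the multiplication operator.\<close>
  define \<Gamma> where "\<Gamma> f j = (if j = 1 then X.HU.of_coeffs (X.observe f) else 0)" for f and j :: nat
  have obs: "X.observe f \<in> hcarrier X.HU.l2" if "f \<in> M" for f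
    using X.observe_l2[of f] that by (simp only: X.HU_l2) simp
  have \<Gamma>_in: "\<Gamma> f \<in> hcarrier ?B" if f: "f \<in> M" for f
  proof -
    have "0 \<in> hcarrier (bergman_space j (U j))" if "j \<in> {1..n}" for j
      by (rule complex_inner_space.zero_closed[OF
            complex_hilbert_space_imp_inner[OF bergman.hilbert[OF bergman[OF that]]]])
    moreover have "X.HU.of_coeffs (X.observe f) \<in> hcarrier (bergman_space 1 (U 1))"
      using X.HU.of_coeffs(1)[OF obs[OF f]] by (simp add: U_def)
    ultimately show ?thesis using assms(1) by (auto simp: direct_sum_def \<Gamma>_def)
  qed
  interpret W: adjoint_operators ?B X.K "row_multiplier n F" \<Gamma>
  proof unfold_locales
    show "adjoint_pair ?B X.K (row_multiplier n F) \<Gamma>"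
      unfolding adjoint_pair_def
    proof (intro conjI ballI)
      fix x assume x: "x \<in> hcarrier ?B"
      have a: "X.HU.tc (x 1) \<in> hcarrier X.l2U"
        using X.HU.taylor(1)[OF x1[OF x]] by (simp only: X.HU_l2)
      show "row_multiplier n F x \<in> hcarrier X.K" unfolding row[OF x] by (rule X.control(1)[OF a])
      fix f assume f: "f \<in> hcarrier X.K"
      have "hinner X.K (X.control (X.HU.tc (x 1))) f = hinner X.l2U (X.HU.tc (x 1)) (X.observe f)"
        by (rule adjoint_pair_inner[OF X.control_observe a f])
      also have "\<dots> = hinner ?B x (\<Gamma> f)"
        using X.HU.of_coeffs(3)[OF obs, of f] f
        unfolding inner_B X.HU.inner_eq \<Gamma>_def X.HU_l2[symmetric] by simp
      finally show "hinner X.K (row_multiplier n F x) f = hinner ?B x (\<Gamma> f)"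
        unfolding row[OF x] .
    qed (use \<Gamma>_in in auto)
  qed
  have "hnorm ?B (\<Gamma> f) = hnorm X.K f" if f: "f \<in> hcarrier X.K" for f
  proof -
    have "hnorm ?B (\<Gamma> f) = hnorm X.l2U (X.observe f)"
      using X.HU.of_coeffs(3)[OF obs, of f] f
      unfolding hnorm_def inner_B X.HU.inner_eq \<Gamma>_def X.HU_l2[symmetric] by simp
    then show ?thesis using X.observe_isometric[OF f] by simp
  qed
  note co = W.coisometry[OF this]
  have "partial_isometry ?B (bergman_space n Y) (row_multiplier n F)"
    using co(1) X.M_subset
    by (auto simp: partial_isometry_def bounded_operators_def X.hnorm_K)
  moreover have "M = row_multiplier n F ` hcarrier ?B" using co(2) by simp
  ultimately show ?thesis using U F by blast
qed

end
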